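(* Let $p\in(1,\infty)$. Then $$\overline{H^p(D'_\beta)\cap\mathcal C(\overline{D'_\beta})}^{\,\|\cdot\|_{H^p(D'_\beta)}}=H^p(D'_\beta),$$ i.e. the functions in $H^p(D'_\beta)$ that extend continuously to the closure $\overline{D'_\beta}$ are dense in $H^p(D'_\beta)$.
   Context: Fix $\beta>\frac{\pi}{2}$. Let $$D'_\beta=\{(z_1,z_2)\in\mathbb C^2: |\operatorname{Im}z_1-\log|z_2|^2|<\tfrac{\pi}{2},\ |\log|z_2|^2|<\beta-\tfrac{\pi}{2}\}.$$ For $p\in(1,\infty)$, $H^p(D'_\beta)$ is the space of holomorphic $F$ on $D'_\beta$ such that $$\|F\|^p_{H^p(D'_\beta)}=\sup_{(t,s)\in[0,\frac\pi2)\times[0,\beta-\frac\pi2)}\mathcal L_pF(t,s)<\infty,$$ where \begin{align*} \mathcal L_pF(t,s)=&\int_{\mathbb R}\int_0^1|F(x+i(s+t),e^{\frac s2}e^{2\pi i\theta})|^pd\theta dx+\int_{\mathbb R}\int_0^1|F(x-i(s+t),e^{-\frac s2}e^{2\pi i\theta})|^pd\theta dx\\ &+\int_{\mathbb R}\int_0^1|F(x+i(s-t),e^{\frac s2}e^{2\pi i\theta})|^pd\theta dx+\int_{\mathbb R}\int_0^1|F(x-i(s-t),e^{-\frac s2}e^{2\pi i\theta})|^pd\theta dx. \end{align*} *)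

theory Defs
  imports "HOL-Analysis.Analysis"
begin

text \<open>
  Functions on \<open>D'\<^sub>\<beta>\<close> are represented by total functions on \<open>complex \<times> complex\<close>. Every notion
  below depends only on the values in \<open>D'\<^sub>\<beta>\<close>, which is open.
\<close>

definition holomorphic2_on :: "(complex \<times> complex \<Rightarrow> complex) \<Rightarrow> (complex \<times> complex) set \<Rightarrow> bool"
    (infixl \<open>holomorphic2'_on\<close> 50)
  where "F holomorphic2_on U \<longleftrightarrow>
    (\<forall>z\<in>U. \<exists>a b. (F has_derivative (\<lambda>(h, k). a * h + b * k)) (at z))"

text \<open>
  The condition \<open>z\<^sub>2 \<noteq> 0\<close> is implicit on paper, where \<open>log 0 = -\<infinity>\<close>, but \<open>ln 0 = 0\<close> in HOL.
\<close>

definition D' :: "real \<Rightarrow> (complex \<times> complex) set"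
  where "D' \<beta> = {(z1, z2). z2 \<noteq> 0 \<and>
      \<bar>Im z1 - ln ((cmod z2)\<^sup>2)\<bar> < pi / 2 \<and> \<bar>ln ((cmod z2)\<^sup>2)\<bar> < \<beta> - pi / 2}"

definition slice_integral ::
    "real \<Rightarrow> (complex \<times> complex \<Rightarrow> complex) \<Rightarrow> real \<Rightarrow> real \<Rightarrow> ennreal"
  where "slice_integral p F y r =
    (\<integral>\<^sup>+x. (\<integral>\<^sup>+\<theta>\<in>{0..1}.
        ennreal (cmod (F (of_real x + \<i> * of_real y, of_real r * cis (2 * pi * \<theta>))) powr p)
      \<partial>lborel) \<partial>lborel)"

definition Lp_op :: "real \<Rightarrow> (complex \<times> complex \<Rightarrow> complex) \<Rightarrow> real \<Rightarrow> real \<Rightarrow> ennreal"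
  where "Lp_op p F t s =
      slice_integral p F (s + t) (exp (s / 2))
    + slice_integral p F (- (s + t)) (exp (- s / 2))
    + slice_integral p F (s - t) (exp (s / 2))
    + slice_integral p F (- (s - t)) (exp (- s / 2))"

definition hardy_sup :: "real \<Rightarrow> real \<Rightarrow> (complex \<times> complex \<Rightarrow> complex) \<Rightarrow> ennreal"
  where "hardy_sup \<beta> p F =
    (SUP (t, s) \<in> {0..<pi / 2} \<times> {0..<\<beta> - pi / 2}. Lp_op p F t s)"

definition hardy_space :: "real \<Rightarrow> real \<Rightarrow> (complex \<times> complex \<Rightarrow> complex) set"
  where "hardy_space \<beta> p = {F. F holomorphic2_on D' \<beta> \<and> hardy_sup \<beta> p F < \<infinity>}"

text \<open>Meaningful on \<^const>\<open>hardy_space\<close> only: \<^const>\<open>enn2real\<close> sends \<open>\<infinity>\<close> to \<open>0\<close>.\<close>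

definition hardy_norm :: "real \<Rightarrow> real \<Rightarrow> (complex \<times> complex \<Rightarrow> complex) \<Rightarrow> real"
  where "hardy_norm \<beta> p F = enn2real (hardy_sup \<beta> p F) powr (1 / p)"

definition extends_continuously_to_closure ::
    "(complex \<times> complex \<Rightarrow> complex) \<Rightarrow> (complex \<times> complex) set \<Rightarrow> bool"
  where "extends_continuously_to_closure F U \<longleftrightarrow>
    (\<exists>G. continuous_on (closure U) G \<and> (\<forall>z\<in>U. G z = F z))"

definition hardy_closure ::
    "real \<Rightarrow> real \<Rightarrow> (complex \<times> complex \<Rightarrow> complex) set \<Rightarrow> (complex \<times> complex \<Rightarrow> complex) set"
  where "hardy_closure \<beta> p A =
    {F \<in> hardy_space \<beta> p. \<forall>\<epsilon>>0. \<exists>G\<in>A. hardy_norm \<beta> p (\<lambda>z. F z - G z) < \<epsilon>}"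

end

theory Submission
  imports Defs "HOL-Complex_Analysis.Complex_Analysis"
begin

text \<open>
  Put \<open>l = ln |z\<^sub>2|\<^sup>2\<close> and \<open>t = Im z\<^sub>1 - l\<close>. Then \<open>D' \<beta>\<close> is the set of points whose coordinates
  \<open>(t, l)\<close> lie in the open rectangle \<open>|t| < pi / 2\<close>, \<open>|l| < \<beta> - pi / 2\<close>, and the group of translations
  of \<open>Re z\<^sub>1\<close> and rotations of \<open>z\<^sub>2\<close> acts on each slice over a point of the rectangle. The four
  integrals in \<^const>\<open>Lp_op\<close> are the \<open>p\<close>-th powers of the \<open>L\<^sup>p\<close> norms of \<open>F\<close> on the slices over \<open>(\<plusminus>t, \<plusminus>s)\<close>,
  so the \<open>p\<close>-th power of the Hardy norm is, up to a factor 4, the supremum over the rectangle of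
  \<open>N\<^sub>F (t, l) = \<parallel>F on the slice over (t, l)\<parallel>\<^sup>p\<close> (\<open>mean_power\<close> below).

  The approximants are averages of \<open>F\<close> over short pieces of one-parameter groups of translations and
  rotations. Such an average is again in \<open>H\<^sup>p\<close>. Averaging along two independent directions gives a
  bounded function by Jensen's inequality. Averaging a bounded function \<open>G\<close> once more over a time \<open>h\<close>
  gives a function whose derivative along that group is \<open>(G (shifted by h) - G) / h\<close>, hence bounded.
  After averaging twice along each of two directions, the function is therefore Lipschitz, hence
  uniformly continuous on \<open>D' \<beta>\<close>, and extends continuously to the closure (\<open>quadruple_avg_extends\<close>).

  By Jensen's inequality, the averages of \<open>F\<close> converge to \<open>F\<close> in the Hardy norm once it is known that
  \<open>\<parallel>F - F\<^sub>\<tau>\<parallel> \<rightarrow> 0\<close> for the translates \<open>F\<^sub>\<tau>\<close> of \<open>F\<close> (\<open>shift_equicontinuous\<close>). This is the heart of the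
  matter: it says that translation is continuous uniformly up to the boundary of the rectangle. The
  proof replaces boundary values by convexity.

  The one-parameter groups extend to complex times, which move along the lines of the rectangle
  (\<open>flow_tube_pt\<close>). Since \<open>|F|\<^sup>p\<close> is subharmonic along complexified orbits and real times preserve the slice
  integrals, \<open>N\<^sub>F\<close> has the sub-mean value property along every line of the rectangle, so it is convex there
  (\<open>mean_power_convex\<close>). Applied to \<open>F - F\<^sub>\<tau>\<close>, this reduces the supremum over the rectangle to points
  approaching the four corners along the diagonals. On such a ray \<open>u \<mapsto> u v\<close>, \<open>0 \<le> u < 1\<close>, compare \<open>F\<close> with the midpoint
  \<open>G = (F + F\<^sub>\<tau>) / 2\<close>. Choose \<open>u\<^sub>0\<close> close to \<open>1\<close> such that \<open>N\<^sub>F\<close> is nowhere much larger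
  beyond \<open>u\<^sub>0\<close> than at \<open>u\<^sub>0\<close>. By Fatou's lemma \<open>N\<^sub>G (u\<^sub>0)\<close> is at least
  about \<open>N\<^sub>F (u\<^sub>0)\<close> for small \<open>\<tau>\<close>. By convexity a bounded \<open>N\<^sub>G\<close> can decrease only by a multiple of \<open>1 - u\<^sub>0\<close>
  between \<open>u\<^sub>0\<close> and \<open>1\<close>. So the norm of the midpoint of \<open>F\<close> and \<open>F\<^sub>\<tau>\<close> is almost as large as the norms of
  \<open>F\<close> and \<open>F\<^sub>\<tau>\<close> on the whole ray beyond \<open>u\<^sub>0\<close>, and the uniform convexity of \<open>L\<^sup>p\<close>, for which \<open>p > 1\<close>
  is essential, makes \<open>F - F\<^sub>\<tau>\<close> small there (\<open>ray_equicontinuous\<close>).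
\<close>

section \<open>Integration over the unit interval and the cylinder\<close>

abbreviation unit_measure :: "real measure"
  where "unit_measure \<equiv> density lborel (indicator {0..1})"

lemma nn_integral_unit:
  assumes "f \<in> borel_measurable borel"
  shows "(\<integral>\<^sup>+\<theta>\<in>{0..1}. f \<theta> \<partial>lborel) = (\<integral>\<^sup>+\<theta>. f \<theta> \<partial>unit_measure)"
  using assms by (subst nn_integral_density) (auto simp: mult.commute)

lemma nn_integral_const_unit: "(\<integral>\<^sup>+\<theta>. c \<partial>unit_measure) = c"
  by (simp add: nn_integral_const emeasure_density)

lemma sigma_finite_unit: "sigma_finite_measure unit_measure"
  by (rule finite_measure.axioms, rule finite_measureI) (simp add: emeasure_density)

interpretation unit: sigma_finite_measure unit_measure
  by (rule sigma_finite_unit)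

lemma AE_unit: "AE \<tau> in unit_measure. \<tau> \<in> {0..1}"
  by (subst AE_density) (auto simp: indicator_def)

text \<open>
  Young's inequality for \<open>x\<close> and \<open>m powr (p - 1)\<close>. Integrated with \<open>m\<close> the mean of \<open>x\<close>, it gives Jensen's
  inequality.
\<close>

lemma powr_above_tangent:
  fixes x m p :: real
  assumes "1 < p" "0 \<le> x" "0 \<le> m"
  shows "m powr p + p * m powr (p - 1) * (x - m) \<le> x powr p"
proof (cases "m = 0")
  case False
  then have m: "m > 0" using assms by simp
  have q: "p / (p - 1) > 1" "1 / p + 1 / (p / (p - 1)) = 1"
    using assms by (auto simp: field_simps)
  have "x * m powr (p - 1) \<le> x powr p / p + (m powr (p - 1)) powr (p / (p - 1)) / (p / (p - 1))"
    using assms q by (intro Youngs_inequality) auto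
  also have "(m powr (p - 1)) powr (p / (p - 1)) = m powr p"
    using assms by (simp add: powr_powr)
  finally have "p * (x * m powr (p - 1)) \<le> p * (x powr p / p + m powr p / (p / (p - 1)))"
    using assms by (intro mult_left_mono) auto
  also have "\<dots> = x powr p + (p - 1) * m powr p"
    using assms by (simp add: field_simps)
  finally have 1: "p * (x * m powr (p - 1)) \<le> x powr p + (p - 1) * m powr p" .
  have "m powr p = m * m powr (p - 1)"
    using m by (simp add: powr_mult_base)
  with 1 show ?thesis by (simp add: algebra_simps)
qed (use assms in auto)

lemma jensen_integral:
  fixes h :: "real \<Rightarrow> complex"
  assumes "1 < p" and h: "continuous_on {0..1} h"
  shows "ennreal (cmod (integral {0..1} h) powr p)
    \<le> (\<integral>\<^sup>+\<tau>. ennreal (cmod (h \<tau>) powr p) \<partial>unit_measure)"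
proof -
  define m where "m = integral {0..1} (\<lambda>\<tau>. cmod (h \<tau>))"
  have c1: "continuous_on {0..1} (\<lambda>\<tau>. cmod (h \<tau>))"
    using h by (intro continuous_intros)
  have c2: "continuous_on {0..1} (\<lambda>\<tau>. cmod (h \<tau>) powr p)"
    using h assms by (intro continuous_intros continuous_on_powr') auto
  have i1: "(\<lambda>\<tau>. cmod (h \<tau>)) integrable_on {0..1}" and i2: "(\<lambda>\<tau>. cmod (h \<tau>) powr p) integrable_on {0..1}"
    using c1 c2 by (auto intro: integrable_continuous_real)
  have m0: "0 \<le> m" unfolding m_def by (rule integral_nonneg[OF i1]) auto
  have le_m: "cmod (integral {0..1} h) \<le> m"
    unfolding m_def by (intro integral_norm_bound_integral integrable_continuous_real[OF h] i1) auto
  have a: "(\<lambda>\<tau>. m powr p + p * m powr (p - 1) * (cmod (h \<tau>) - m)) integrable_on {0..1}"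
    using h by (intro integrable_continuous_real continuous_intros)
  have "m powr p = integral {0..1} (\<lambda>\<tau>. m powr p + p * m powr (p - 1) * (cmod (h \<tau>) - m))"
  proof -
    have "((\<lambda>\<tau>. m powr p + p * m powr (p - 1) * (cmod (h \<tau>) - m)) has_integral
        (m powr p + p * m powr (p - 1) * (m - m))) {0..1}"
    proof (intro has_integral_add has_integral_mult_right has_integral_diff)
      show "((\<lambda>\<tau>. cmod (h \<tau>)) has_integral m) {0..1}"
        unfolding m_def using i1 by (rule integrable_integral)
    qed (use has_integral_const_real[of _ 0 1] in auto)
    then show ?thesis by (simp add: integral_unique)
  qed
  also have "\<dots> \<le> integral {0..1} (\<lambda>\<tau>. cmod (h \<tau>) powr p)"
    using powr_above_tangent[OF assms(1) _ m0] by (intro integral_le a i2) auto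
  finally have le: "m powr p \<le> integral {0..1} (\<lambda>\<tau>. cmod (h \<tau>) powr p)" .
  have "(\<integral>\<^sup>+\<tau>. ennreal (cmod (h \<tau>) powr p) \<partial>unit_measure) =
     (\<integral>\<^sup>+\<tau>. ennreal (cmod (h \<tau>) powr p) * indicator {0..1} \<tau> \<partial>lborel)"
  proof -
    have m: "(\<lambda>\<tau>. ennreal (indicator {0..1} \<tau> *\<^sub>R (cmod (h \<tau>) powr p))) \<in> borel_measurable borel"
      using borel_measurable_continuous_on_indicator[OF _ c2] by auto
    have eq: "ennreal (indicator {0..1} \<tau> *\<^sub>R (cmod (h \<tau>) powr p)) =
        ennreal (cmod (h \<tau>) powr p) * indicator {0..1} \<tau>" for \<tau> :: real
      by (simp add: indicator_def)
    have "(\<integral>\<^sup>+\<tau>. ennreal (cmod (h \<tau>) powr p) \<partial>unit_measure) =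
       (\<integral>\<^sup>+\<tau>. ennreal (indicator {0..1} \<tau> *\<^sub>R (cmod (h \<tau>) powr p)) \<partial>unit_measure)"
      using AE_unit by (intro nn_integral_cong_AE) (auto simp: indicator_def)
    also have "\<dots> = (\<integral>\<^sup>+\<tau>. ennreal (cmod (h \<tau>) powr p) * indicator {0..1} \<tau> \<partial>lborel)"
      using m by (subst nn_integral_density) (auto simp: indicator_def intro!: nn_integral_cong)
    finally show ?thesis .
  qed
  also have "\<dots> = ennreal (integral {0..1} (\<lambda>\<tau>. cmod (h \<tau>) powr p))"
    using i2 by (intro nn_integral_has_integral_lebesgue' integrable_integral) auto
  finally have eq: "(\<integral>\<^sup>+\<tau>. ennreal (cmod (h \<tau>) powr p) \<partial>unit_measure) = \<dots>" .
  have "cmod (integral {0..1} h) powr p \<le> m powr p"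
    using le_m assms by (intro powr_mono2) auto
  with le show ?thesis unfolding eq by (intro ennreal_leI) simp
qed

lemma nn_integral_unit_shift_small:
  fixes f :: "real \<Rightarrow> ennreal"
  assumes [measurable]: "f \<in> borel_measurable borel" and per: "\<And>\<theta>. f (\<theta> + 1) = f \<theta>"
    and c: "0 \<le> c" "c \<le> 1"
  shows "(\<integral>\<^sup>+\<theta>. f (\<theta> + c) \<partial>unit_measure) = (\<integral>\<^sup>+\<theta>. f \<theta> \<partial>unit_measure)"
proof -
  have aff: "(\<integral>\<^sup>+x. g x \<partial>lborel) = (\<integral>\<^sup>+x. g (x + a) \<partial>lborel)"
    if [measurable]: "g \<in> borel_measurable borel" for g :: "real \<Rightarrow> ennreal" and a
    by (subst nn_integral_real_affine[of g 1 a]) (auto simp: add.commute)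
  have U: "(\<integral>\<^sup>+\<theta>. g \<theta> \<partial>unit_measure) = (\<integral>\<^sup>+\<theta>. g \<theta> * indicator {0..<1} \<theta> \<partial>lborel)"
    if [measurable]: "g \<in> borel_measurable borel" for g :: "real \<Rightarrow> ennreal"
    unfolding nn_integral_unit[OF that, symmetric]
    using AE_lborel_singleton[of "1::real"] by (intro nn_integral_cong_AE) (auto simp: indicator_def)
  have "(\<integral>\<^sup>+\<theta>. f (\<theta> + c) \<partial>unit_measure) = (\<integral>\<^sup>+\<theta>. f (\<theta> + c) * indicator {0..<1} \<theta> \<partial>lborel)"
    by (intro U) simp
  also have "\<dots> = (\<integral>\<^sup>+\<theta>. f \<theta> * indicator {c..<1} \<theta> + f \<theta> * indicator {1..<1 + c} \<theta> \<partial>lborel)"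
    using c by (subst aff[of _ "-c"]) (auto intro!: nn_integral_cong simp: indicator_def)
  also have "\<dots> = (\<integral>\<^sup>+\<theta>. f \<theta> * indicator {c..<1} \<theta> \<partial>lborel) + (\<integral>\<^sup>+\<theta>. f \<theta> * indicator {1..<1 + c} \<theta> \<partial>lborel)"
    by (intro nn_integral_add) auto
  also have "(\<integral>\<^sup>+\<theta>. f \<theta> * indicator {1..<1 + c} \<theta> \<partial>lborel) = (\<integral>\<^sup>+\<theta>. f \<theta> * indicator {0..<c} \<theta> \<partial>lborel)"
    by (subst aff[of _ 1]) (auto intro!: nn_integral_cong simp: indicator_def per)
  also have "(\<integral>\<^sup>+\<theta>. f \<theta> * indicator {c..<1} \<theta> \<partial>lborel) + \<dots> =
      (\<integral>\<^sup>+\<theta>. f \<theta> * indicator {c..<1} \<theta> + f \<theta> * indicator {0..<c} \<theta> \<partial>lborel)"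
    by (intro nn_integral_add[symmetric]) auto
  also have "\<dots> = (\<integral>\<^sup>+\<theta>. f \<theta> * indicator {0..<1} \<theta> \<partial>lborel)"
    using c by (intro nn_integral_cong) (auto simp: indicator_def)
  also have "\<dots> = (\<integral>\<^sup>+\<theta>. f \<theta> \<partial>unit_measure)"
    by (intro U[symmetric]) simp
  finally show ?thesis .
qed

lemma nn_integral_unit_shift:
  fixes f :: "real \<Rightarrow> ennreal"
  assumes [measurable]: "f \<in> borel_measurable borel" and per: "\<And>\<theta>. f (\<theta> + 1) = f \<theta>"
  shows "(\<integral>\<^sup>+\<theta>. f (\<theta> + c) \<partial>unit_measure) = (\<integral>\<^sup>+\<theta>. f \<theta> \<partial>unit_measure)"
proof -
  have n: "f (\<theta> + of_nat n) = f \<theta>" for \<theta> n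
    using per[of "\<theta> + of_nat k" for k] by (induction n) (auto simp: ac_simps)
  have i: "f (\<theta> + of_int k) = f \<theta>" for \<theta> k
    using n[of \<theta> "nat k"] n[of "\<theta> + of_int k" "nat (- k)"] by (cases "k \<ge> 0") auto
  have "f (\<theta> + c) = f (\<theta> + frac c)" for \<theta>
    using i[of "\<theta> + frac c" "floor c"] by (simp add: frac_def algebra_simps)
  then show ?thesis
    using frac_lt_1[of c] by (simp add: nn_integral_unit_shift_small per)
qed

text \<open>
  A slice of the domain is parametrised by \<open>(x, \<theta>)\<close>, with \<open>x\<close> the real part of the first coordinate and
  \<open>2 * pi * \<theta>\<close> the argument of the second; this is the measure on a slice in \<^const>\<open>slice_integral\<close>.
\<close>

abbreviation cyl_measure :: "(real \<times> real) measure"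
  where "cyl_measure \<equiv> lborel \<Otimes>\<^sub>M unit_measure"

interpretation cyl: pair_sigma_finite lborel unit_measure ..

lemma sigma_finite_cyl: "sigma_finite_measure cyl_measure"
  by (intro sigma_finite_pair_measure lborel.sigma_finite_measure_axioms unit.sigma_finite_measure_axioms)

interpretation cyl_unit: pair_sigma_finite cyl_measure unit_measure
  using sigma_finite_cyl unit.sigma_finite_measure_axioms by (simp add: pair_sigma_finite_def)

lemma sets_cyl [measurable_cong]: "sets cyl_measure = sets borel"
  unfolding borel_prod[symmetric] by (intro sets_pair_measure_cong) auto

lemma sets_cyl_unit [measurable_cong]: "sets (cyl_measure \<Otimes>\<^sub>M unit_measure) = sets borel"
  unfolding borel_prod[symmetric] using sets_cyl
  by (intro sets_pair_measure_cong) (auto simp: borel_prod)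

lemma borel_measurable_cyl: "f \<in> borel_measurable borel \<Longrightarrow> f \<in> borel_measurable cyl_measure"
  using measurable_cong_sets[OF sets_cyl refl] by blast

lemma nn_integral_cyl_shift:
  fixes f :: "real \<times> real \<Rightarrow> ennreal"
  assumes [measurable]: "f \<in> borel_measurable borel" and per: "\<And>x \<theta>. f (x, \<theta> + 1) = f (x, \<theta>)"
  shows "(\<integral>\<^sup>+\<omega>. f (fst \<omega> + a, snd \<omega> + b) \<partial>cyl_measure) = (\<integral>\<^sup>+\<omega>. f \<omega> \<partial>cyl_measure)"
proof -
  have f': "f \<in> borel_measurable cyl_measure" by (intro borel_measurable_cyl assms)
  have s: "(\<lambda>\<omega>::real \<times> real. (fst \<omega> + a, snd \<omega> + b)) \<in> borel_measurable borel"
    by (intro borel_measurable_continuous_onI continuous_intros)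
  have f'': "(\<lambda>\<omega>. f (fst \<omega> + a, snd \<omega> + b)) \<in> borel_measurable cyl_measure"
    using measurable_compose[OF s assms(1)] by (rule borel_measurable_cyl)
  have 1: "(\<lambda>\<theta>. f (x, \<theta>)) \<in> borel_measurable borel" for x
    by (simp add: borel_prod[symmetric])
  have 2: "(\<lambda>x. \<integral>\<^sup>+\<theta>. f (x, \<theta>) \<partial>unit_measure) \<in> borel_measurable lborel"
    using unit.borel_measurable_nn_integral_fst[OF f'] .
  have "(\<integral>\<^sup>+\<omega>. f (fst \<omega> + a, snd \<omega> + b) \<partial>cyl_measure)
      = (\<integral>\<^sup>+x. (\<integral>\<^sup>+\<theta>. f (x + a, \<theta> + b) \<partial>unit_measure) \<partial>lborel)"
    by (subst unit.nn_integral_fst[symmetric]) (auto simp: f'')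
  also have "\<dots> = (\<integral>\<^sup>+x. (\<integral>\<^sup>+\<theta>. f (x + a, \<theta>) \<partial>unit_measure) \<partial>lborel)"
    by (intro nn_integral_cong nn_integral_unit_shift 1 per)
  also have "\<dots> = (\<integral>\<^sup>+x. (\<integral>\<^sup>+\<theta>. f (x, \<theta>) \<partial>unit_measure) \<partial>lborel)"
    using 2 by (subst (2) nn_integral_real_affine[of _ 1 a]) (auto simp: add.commute)
  also have "\<dots> = (\<integral>\<^sup>+\<omega>. f \<omega> \<partial>cyl_measure)"
    by (subst unit.nn_integral_fst[symmetric]) (auto simp: f')
  finally show ?thesis .
qed

section \<open>Flows and one-variable Cauchy estimates\<close>

text \<open>
  The point \<open>(z\<^sub>1, z\<^sub>2)\<close> with \<open>Im z\<^sub>1 - ln |z\<^sub>2|\<^sup>2 = t\<close>, \<open>ln |z\<^sub>2|\<^sup>2 = l\<close>, \<open>Re z\<^sub>1 = fst \<omega>\<close> and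
  \<open>arg z\<^sub>2 = 2 * pi * snd \<omega>\<close>. In the coordinates \<open>(t, l)\<close> the domain becomes a rectangle.
\<close>

definition tube_pt :: "real \<Rightarrow> real \<Rightarrow> real \<times> real \<Rightarrow> complex \<times> complex"
  where "tube_pt t l \<omega> = (of_real (fst \<omega>) + \<i> * of_real (t + l), of_real (exp (l / 2)) * cis (2 * pi * snd \<omega>))"

text \<open>
  For real \<open>\<zeta>\<close> this is a translation of the first and a rotation of the second coordinate, which preserves
  all slices. Complex \<open>\<zeta>\<close> extend the group action holomorphically and move between the slices.
\<close>

definition flow :: "real \<Rightarrow> real \<Rightarrow> complex \<Rightarrow> complex \<times> complex \<Rightarrow> complex \<times> complex"
  where "flow c d \<zeta> z = (fst z + of_real c * \<zeta>, snd z * exp (- \<i> * of_real d * \<zeta>))"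

lemma flow_flow: "flow c d \<zeta> (flow c d \<xi> z) = flow c d (\<zeta> + \<xi>) z"
  by (simp add: flow_def algebra_simps exp_add[symmetric])

lemma flow_0 [simp]: "flow c d 0 z = z"
  by (simp add: flow_def)

lemma continuous_on_flow [continuous_intros]:
  "continuous_on A f \<Longrightarrow> continuous_on A g \<Longrightarrow> continuous_on A (\<lambda>x. flow c d (f x) (g x))"
  unfolding flow_def by (intro continuous_intros)

lemma continuous_on_tube_pt [continuous_intros]:
  "continuous_on A f \<Longrightarrow> continuous_on A g \<Longrightarrow> continuous_on A h \<Longrightarrow> continuous_on A (\<lambda>x. tube_pt (f x) (g x) (h x))"
  unfolding tube_pt_def by (intro continuous_intros) auto

text \<open>
  The imaginary part of \<open>\<zeta>\<close> moves \<open>(t, l)\<close> along a line of direction \<open>(c - 2 * d, 2 * d)\<close>, and the real part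
  moves within the slice. Every direction arises from suitable \<open>c\<close> and \<open>d\<close>.
\<close>

lemma flow_tube_pt:
  "flow c d \<zeta> (tube_pt t l \<omega>) =
    tube_pt (t + (c - 2 * d) * Im \<zeta>) (l + 2 * d * Im \<zeta>) (fst \<omega> + c * Re \<zeta>, snd \<omega> - d * Re \<zeta> / (2 * pi))"
proof -
  have e: "exp (- \<i> * of_real d * \<zeta>) = of_real (exp (d * Im \<zeta>)) * cis (- d * Re \<zeta>)"
    by (simp add: exp_eq_polar)
  have "of_real c * \<zeta> = of_real (c * Re \<zeta>) + \<i> * of_real (c * Im \<zeta>)"
    by (simp add: complex_eq_iff)
  then have 1: "fst (flow c d \<zeta> (tube_pt t l \<omega>)) = fst (tube_pt (t + (c - 2 * d) * Im \<zeta>) (l + 2 * d * Im \<zeta>) (fst \<omega> + c * Re \<zeta>, snd \<omega> - d * Re \<zeta> / (2 * pi)))"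
    by (simp add: flow_def tube_pt_def algebra_simps)
  have c: "cis (2 * pi * snd \<omega>) * cis (- d * Re \<zeta>) = cis (2 * pi * (snd \<omega> - d * Re \<zeta> / (2 * pi)))"
    by (simp add: cis_mult algebra_simps)
  have x: "exp (l / 2) * exp (d * Im \<zeta>) = exp ((l + 2 * d * Im \<zeta>) / 2)"
    by (simp add: exp_add[symmetric] add_divide_distrib)
  have "snd (flow c d \<zeta> (tube_pt t l \<omega>)) =
     of_real (exp (l / 2) * exp (d * Im \<zeta>)) * (cis (2 * pi * snd \<omega>) * cis (- d * Re \<zeta>))"
    unfolding flow_def tube_pt_def snd_conv e by simp
  also have "\<dots> = snd (tube_pt (t + (c - 2 * d) * Im \<zeta>) (l + 2 * d * Im \<zeta>) (fst \<omega> + c * Re \<zeta>, snd \<omega> - d * Re \<zeta> / (2 * pi)))"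
    unfolding c x tube_pt_def by simp
  finally show ?thesis using 1 by (simp add: prod_eq_iff)
qed

lemma cis_2pi_add1: "cis (2 * pi * (\<theta> + 1)) = cis (2 * pi * \<theta>)"
  by (simp add: distrib_left cis_mult[symmetric])

lemma tube_pt_periodic [simp]: "tube_pt t l (x, \<theta> + 1) = tube_pt t l (x, \<theta>)"
  unfolding tube_pt_def snd_conv cis_2pi_add1 by simp

lemma circlepath_0_eq_cis: "circlepath 0 \<rho> x = of_real \<rho> * cis (2 * pi * x)"
  by (simp add: circlepath cis_conv_exp mult_ac)

lemma has_contour_integral_circle:
  assumes "(f has_contour_integral I) (circlepath 0 \<rho>)"
  shows "((\<lambda>\<phi>. f (of_real \<rho> * cis (2 * pi * \<phi>)) * (of_real \<rho> * cis (2 * pi * \<phi>)))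
    has_integral I / (2 * of_real pi * \<i>)) {0..1}"
proof -
  have v: "vector_derivative (circlepath 0 \<rho>) (at x within {0..1}) = 2 * of_real pi * \<i> * (of_real \<rho> * cis (2 * pi * x))"
    if "x \<in> {0..1}" for x
  proof -
    have e: "exp (2 * of_real pi * \<i> * of_real x) = cis (2 * pi * x)"
      by (simp add: cis_conv_exp mult_ac)
    show ?thesis
      using that vector_derivative_circlepath01[of x 0 \<rho>] unfolding e by simp
  qed
  have "((\<lambda>x. f (of_real \<rho> * cis (2 * pi * x)) * (2 * of_real pi * \<i> * (of_real \<rho> * cis (2 * pi * x)))) has_integral I) {0..1}"
    using assms unfolding has_contour_integral_def
    by (rule has_integral_eq[rotated]) (simp only: v, simp only: circlepath_0_eq_cis)
  then have "((\<lambda>x. 1 / (2 * of_real pi * \<i>) * (f (of_real \<rho> * cis (2 * pi * x)) * (2 * of_real pi * \<i> * (of_real \<rho> * cis (2 * pi * x)))))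
      has_integral 1 / (2 * of_real pi * \<i>) * I) {0..1}"
    by (rule has_integral_mult_right)
  moreover have "1 / k * (a * (k * b)) = a * b" "1 / k * I = I / k" if "k \<noteq> 0" for a b k :: complex
    using that by simp_all
  note this[of "2 * of_real pi * \<i>"]
  ultimately show ?thesis by (simp only: mult_eq_0_iff of_real_eq_0_iff pi_neq_zero complex_i_not_zero zero_neq_numeral[symmetric] simp_thms not_False_eq_True)
qed

lemma circle_mean:
  assumes g: "continuous_on (cball 0 \<rho>) g" "g holomorphic_on ball 0 \<rho>" and "cmod \<zeta> < \<rho>"
  shows "g \<zeta> = integral {0..1} (\<lambda>\<phi>. g (of_real \<rho> * cis (2 * pi * \<phi>)) *
    (of_real \<rho> * cis (2 * pi * \<phi>) / (of_real \<rho> * cis (2 * pi * \<phi>) - \<zeta>)))"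
proof -
  have "((\<lambda>u. g u / (u - \<zeta>)) has_contour_integral (2 * of_real pi * \<i> * g \<zeta>)) (circlepath 0 \<rho>)"
    using assms by (intro Cauchy_integral_circlepath) auto
  from integral_unique[OF has_contour_integral_circle[OF this]] show ?thesis by simp
qed

lemma circle_mean_deriv:
  assumes g: "continuous_on (cball 0 \<rho>) g" "g holomorphic_on ball 0 \<rho>" and "0 < \<rho>"
  shows "deriv g 0 = integral {0..1} (\<lambda>\<phi>. g (of_real \<rho> * cis (2 * pi * \<phi>)) / (of_real \<rho> * cis (2 * pi * \<phi>)))"
proof -
  have 0: "(0::complex) \<in> ball 0 \<rho>" using assms by simp
  note C = Cauchy_derivative_integral_circlepath[OF g 0]
  have d: "deriv g 0 = contour_integral (circlepath 0 \<rho>) (\<lambda>u. g u / (u - 0)\<^sup>2) / (2 * of_real pi * \<i>)"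
    using DERIV_imp_deriv[OF C(2)] by simp
  have "((\<lambda>u. g u / (u - 0)\<^sup>2) has_contour_integral contour_integral (circlepath 0 \<rho>) (\<lambda>u. g u / (u - 0)\<^sup>2)) (circlepath 0 \<rho>)"
    using C(1) by (rule has_contour_integral_integral)
  from has_contour_integral_circle[OF this]
  have "((\<lambda>\<phi>. g (of_real \<rho> * cis (2 * pi * \<phi>)) / (of_real \<rho> * cis (2 * pi * \<phi>) - 0)\<^sup>2 * (of_real \<rho> * cis (2 * pi * \<phi>)))
      has_integral deriv g 0) {0..1}"
    unfolding d .
  then have "deriv g 0 = integral {0..1} (\<lambda>\<phi>. g (of_real \<rho> * cis (2 * pi * \<phi>)) / (of_real \<rho> * cis (2 * pi * \<phi>) - 0)\<^sup>2 * (of_real \<rho> * cis (2 * pi * \<phi>)))"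
    by (simp only: integral_unique)
  also have "\<dots> = integral {0..1} (\<lambda>\<phi>. g (of_real \<rho> * cis (2 * pi * \<phi>)) / (of_real \<rho> * cis (2 * pi * \<phi>)))"
    using assms by (intro integral_cong) (simp add: power2_eq_square)
  finally show ?thesis .
qed

text \<open>
  A bound for \<open>|g|\<^sup>p\<close> near the centre that is uniform in \<open>\<zeta>\<close>. It supplies an integrable majorant when
  \<open>\<zeta>\<close> varies.
\<close>

lemma circle_power_bound:
  assumes g: "continuous_on (cball 0 \<rho>) g" "g holomorphic_on ball 0 \<rho>" and "0 < \<rho>" "1 < p"
    and \<zeta>: "cmod \<zeta> \<le> \<rho> / 2"
  shows "ennreal (cmod (g \<zeta>) powr p) \<le>
    ennreal (2 powr p) * (\<integral>\<^sup>+\<phi>. ennreal (cmod (g (of_real \<rho> * cis (2 * pi * \<phi>))) powr p) \<partial>unit_measure)"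
proof -
  let ?u = "\<lambda>\<phi>. of_real \<rho> * cis (2 * pi * \<phi>)"
  have mult2: "cmod (x * y) \<le> 2 * cmod x" if "cmod y \<le> 2" for x y
    using mult_left_mono[OF that, of "cmod x"] by (simp add: norm_mult)
  have ne: "cmod (?u \<phi> - \<zeta>) \<ge> \<rho> / 2" for \<phi>
    using norm_triangle_ineq2[of "?u \<phi>" \<zeta>] assms by (simp add: norm_mult)
  then have ne0: "?u \<phi> - \<zeta> \<noteq> 0" for \<phi>
    using assms(3) by (metis half_gt_zero leD norm_zero)
  have c: "continuous_on {0..1} (\<lambda>\<phi>. g (?u \<phi>) * (?u \<phi> / (?u \<phi> - \<zeta>)))"
    using assms ne0
    by (intro continuous_intros continuous_on_compose2[OF g(1)]) (auto simp: norm_mult)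
  have m: "(\<lambda>\<phi>. ennreal (cmod (g (?u \<phi>)) powr p)) \<in> borel_measurable borel"
    using assms
    by (intro measurable_compose[OF _ measurable_ennreal] borel_measurable_continuous_onI)
      (auto intro!: continuous_intros continuous_on_powr' continuous_on_compose2[OF g(1)] simp: norm_mult)
  have "g \<zeta> = integral {0..1} (\<lambda>\<phi>. g (?u \<phi>) * (?u \<phi> / (?u \<phi> - \<zeta>)))"
    using assms by (intro circle_mean g) auto
  then have "ennreal (cmod (g \<zeta>) powr p) \<le> (\<integral>\<^sup>+\<phi>. ennreal (cmod (g (?u \<phi>) * (?u \<phi> / (?u \<phi> - \<zeta>))) powr p) \<partial>unit_measure)"
    using jensen_integral[OF \<open>1 < p\<close> c] by simp
  also have "\<dots> \<le> (\<integral>\<^sup>+\<phi>. ennreal (2 powr p) * ennreal (cmod (g (?u \<phi>)) powr p) \<partial>unit_measure)"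
  proof (intro nn_integral_mono)
    fix \<phi> :: real
    have "cmod (?u \<phi> / (?u \<phi> - \<zeta>)) \<le> 2"
      using ne[of \<phi>] ne0[of \<phi>] assms by (simp add: norm_divide norm_mult divide_simps)
    then have "cmod (g (?u \<phi>) * (?u \<phi> / (?u \<phi> - \<zeta>))) \<le> 2 * cmod (g (?u \<phi>))"
      by (rule mult2)
    then have "cmod (g (?u \<phi>) * (?u \<phi> / (?u \<phi> - \<zeta>))) powr p \<le> (2 * cmod (g (?u \<phi>))) powr p"
      using assms by (intro powr_mono2) auto
    then show "ennreal (cmod (g (?u \<phi>) * (?u \<phi> / (?u \<phi> - \<zeta>))) powr p) \<le> ennreal (2 powr p) * ennreal (cmod (g (?u \<phi>)) powr p)"
      by (simp add: ennreal_mult[symmetric] powr_mult)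
  qed
  also have "\<dots> = ennreal (2 powr p) * (\<integral>\<^sup>+\<phi>. ennreal (cmod (g (?u \<phi>)) powr p) \<partial>unit_measure)"
    using m by (intro nn_integral_cmult) auto
  finally show ?thesis .
qed

lemma circle_power_mean:
  assumes g: "continuous_on (cball 0 \<rho>) g" "g holomorphic_on ball 0 \<rho>" and "0 < \<rho>" "1 < p"
  shows "ennreal (cmod (g 0) powr p) \<le>
    (\<integral>\<^sup>+\<phi>. ennreal (cmod (g (of_real \<rho> * cis (2 * pi * \<phi>))) powr p) \<partial>unit_measure)"
proof -
  have "g 0 = integral {0..1} (\<lambda>\<phi>. g (of_real \<rho> * cis (2 * pi * \<phi>)))"
    using circle_mean[OF g, of 0] assms by simp
  moreover have "continuous_on {0..1} (\<lambda>\<phi>. g (of_real \<rho> * cis (2 * pi * \<phi>)))"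
    using assms by (intro continuous_intros continuous_on_compose2[OF g(1)]) (auto simp: norm_mult)
  ultimately show ?thesis using jensen_integral[OF \<open>1 < p\<close>] by simp
qed

lemma field_differentiable_along_flow:
  assumes "H holomorphic2_on U" "flow c d \<zeta> z \<in> U"
  shows "(\<lambda>\<zeta>. H (flow c d \<zeta> z)) field_differentiable at \<zeta>"
proof -
  obtain a b where ab: "(H has_derivative (\<lambda>(h, k). a * h + b * k)) (at (flow c d \<zeta> z))"
    using assms unfolding holomorphic2_on_def by blast
  have 1: "((\<lambda>\<zeta>. fst z + of_real c * \<zeta>) has_derivative (\<lambda>h. of_real c * h)) (at \<zeta>)"
    by (auto intro!: derivative_eq_intros)
  have 2: "((\<lambda>\<zeta>. snd z * exp (- \<i> * of_real d * \<zeta>)) has_derivative (\<lambda>h. snd z * (exp (- \<i> * of_real d * \<zeta>) * (- \<i> * of_real d)) * h)) (at \<zeta>)"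
    unfolding has_field_derivative_def[symmetric] by (auto intro!: derivative_eq_intros)
  have "((\<lambda>\<zeta>. flow c d \<zeta> z) has_derivative (\<lambda>h. (of_real c * h, snd z * (exp (- \<i> * of_real d * \<zeta>) * (- \<i> * of_real d)) * h))) (at \<zeta>)"
    unfolding flow_def by (intro has_derivative_Pair 1 2)
  from diff_chain_at[OF this ab]
  have "((\<lambda>\<zeta>. H (flow c d \<zeta> z)) has_derivative
      (*) (a * of_real c + b * (snd z * (exp (- \<i> * of_real d * \<zeta>) * (- \<i> * of_real d))))) (at \<zeta>)"
    unfolding o_def by (rule has_derivative_eq_rhs) (simp add: fun_eq_iff algebra_simps)
  then show ?thesis
    unfolding field_differentiable_def has_field_derivative_def by blast
qed

lemma holomorphic2_on_imp_continuous_on: "H holomorphic2_on U \<Longrightarrow> continuous_on U H"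
  unfolding holomorphic2_on_def
  by (meson continuous_at_imp_continuous_on has_derivative_continuous)

lemma holomorphic2_on_cmult:
  assumes "F holomorphic2_on U" shows "(\<lambda>z. c * F z) holomorphic2_on U"
  unfolding holomorphic2_on_def
proof
  fix z assume "z \<in> U"
  then obtain a b where ab: "(F has_derivative (\<lambda>(h, k). a * h + b * k)) (at z)"
    using assms unfolding holomorphic2_on_def by blast
  have "((\<lambda>z. c * F z) has_derivative (\<lambda>h. c * (case h of (h, k) \<Rightarrow> a * h + b * k))) (at z)"
    using ab by (rule has_derivative_mult_right)
  then show "\<exists>a b. ((\<lambda>z. c * F z) has_derivative (\<lambda>(h, k). a * h + b * k)) (at z)"
    by (intro exI[of _ "c * a"] exI[of _ "c * b"]) (auto simp: case_prod_unfold algebra_simps)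
qed

lemma holomorphic2_on_add:
  assumes "F holomorphic2_on U" "G holomorphic2_on U" shows "(\<lambda>z. F z + G z) holomorphic2_on U"
  unfolding holomorphic2_on_def
proof
  fix z assume z: "z \<in> U"
  obtain a b where ab: "(F has_derivative (\<lambda>(h, k). a * h + b * k)) (at z)"
    using assms z unfolding holomorphic2_on_def by blast
  obtain a' b' where ab': "(G has_derivative (\<lambda>(h, k). a' * h + b' * k)) (at z)"
    using assms z unfolding holomorphic2_on_def by blast
  from has_derivative_add[OF ab ab'] show "\<exists>a b. ((\<lambda>z. F z + G z) has_derivative (\<lambda>(h, k). a * h + b * k)) (at z)"
    by (intro exI[of _ "a + a'"] exI[of _ "b + b'"]) (auto simp: case_prod_unfold algebra_simps)
qed

lemma holomorphic2_on_diff: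
  assumes "F holomorphic2_on U" "G holomorphic2_on U" shows "(\<lambda>z. F z - G z) holomorphic2_on U"
  using holomorphic2_on_add[OF assms(1) holomorphic2_on_cmult[OF assms(2), of "-1"]] by simp

lemma has_derivative_compose_flow:
  assumes "(H has_derivative (\<lambda>(h, k). a * h + b * k)) (at (flow c d \<zeta> z))"
  shows "((\<lambda>z. H (flow c d \<zeta> z)) has_derivative (\<lambda>(h, k). a * h + (b * exp (- \<i> * of_real d * \<zeta>)) * k)) (at z)"
proof -
  have "((\<lambda>z. flow c d \<zeta> z) has_derivative (\<lambda>h. (fst h, snd h * exp (- \<i> * of_real d * \<zeta>)))) (at z)"
    unfolding flow_def by (auto intro!: derivative_eq_intros)
  from diff_chain_at[OF this assms] show ?thesis
    by (auto simp: o_def case_prod_unfold algebra_simps)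
qed

lemma holomorphic2_on_compose_flow:
  assumes "H holomorphic2_on U" "\<And>z. z \<in> V \<Longrightarrow> flow c d \<zeta> z \<in> U"
  shows "(\<lambda>z. H (flow c d \<zeta> z)) holomorphic2_on V"
  using assms has_derivative_compose_flow unfolding holomorphic2_on_def by blast

section \<open>Sub-mean value property and convexity\<close>

text \<open>
  The inequality is the sub-mean value property of \<open>\<zeta> \<mapsto> n (Im \<zeta>)\<close> on circles. Subtracting the chord, which satisfies it
  with equality, leaves a function \<open>m\<close> vanishing at both ends. A positive maximum of \<open>m\<close>, taken at its
  leftmost point, would contradict the inequality on a circle reaching to the left of it.
\<close>

lemma submean_imp_convex:
  fixes n :: "real \<Rightarrow> real"
  assumes J: "open J" "convex J" and cont: "continuous_on J n"
    and submean: "\<And>x \<rho>. 0 < \<rho> \<Longrightarrow> {x - \<rho>..x + \<rho>} \<subseteq> J \<Longrightarrow>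
      n x \<le> integral {0..1} (\<lambda>\<phi>. n (x + \<rho> * sin (2 * pi * \<phi>)))"
  shows "convex_on J n"
proof (rule convex_on_linorderI)
  fix t x y :: real assume t: "0 < t" "t < 1" and xy: "x \<in> J" "y \<in> J" "x < y"
  have sub: "{x..y} \<subseteq> J"
    using closed_segment_subset[OF xy(1,2) J(2)] xy(3) by (simp add: closed_segment_eq_real_ivl)
  define k where "k = (n y - n x) / (y - x)"
  define m where "m = (\<lambda>u. n u - (n x + k * (u - x)))"
  have mx: "m x = 0" and my: "m y = 0"
    using xy by (auto simp: m_def k_def)
  have contm: "continuous_on {x..y} m"
    unfolding m_def by (intro continuous_intros continuous_on_subset[OF cont sub])
  have "m u \<le> 0" if u: "u \<in> {x..y}" for u
  proof (rule ccontr)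
    assume "\<not> m u \<le> 0"
    obtain w where w: "w \<in> {x..y}" and wmax: "\<And>v. v \<in> {x..y} \<Longrightarrow> m v \<le> m w"
      using continuous_attains_sup[OF compact_Icc _ contm] u by fastforce
    have mw: "m w > 0" using wmax[OF u] \<open>\<not> m u \<le> 0\<close> by simp
    \<comment> \<open>The leftmost point \<open>v\<close> at which \<open>m\<close> is maximal.\<close>
    define Z where "Z = {v \<in> {x..y}. m v = m w}"
    have "closed Z"
      unfolding Z_def using continuous_closed_preimage_constant[OF contm, of "m w"] by simp
    moreover have "{x..y} \<inter> Z = Z" by (auto simp: Z_def)
    ultimately have "compact Z"
      using compact_Int_closed[OF compact_Icc[of x y], of Z] by simp
    have "Z \<noteq> {}" using w by (auto simp: Z_def)
    obtain v where v: "v \<in> Z" and vmin: "\<And>v'. v' \<in> Z \<Longrightarrow> v \<le> v'"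
      using compact_attains_inf[OF \<open>compact Z\<close> \<open>Z \<noteq> {}\<close>] by blast
    have vxy: "x < v" "v < y"
      using v mw mx my by (auto simp: Z_def less_le)
    define \<rho> where "\<rho> = min (v - x) (y - v)"
    have \<rho>: "\<rho> > 0" "{v - \<rho>..v + \<rho>} \<subseteq> {x..y}" using vxy by (auto simp: \<rho>_def)
    have in_xy: "v + \<rho> * sin a \<in> {x..y}" for a
    proof -
      have "\<bar>\<rho> * sin a\<bar> \<le> \<rho>" using \<rho> by (simp add: abs_mult mult_left_le)
      then show ?thesis using \<rho> by (auto simp: subset_iff abs_le_iff)
    qed
    define h where "h = (\<lambda>\<phi>. m w - m (v + \<rho> * sin (2 * pi * \<phi>)))"
    have ch: "continuous_on {0..1} h"
      unfolding h_def by (intro continuous_intros continuous_on_compose2[OF contm]) (use in_xy in auto)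
    have cn: "(\<lambda>\<phi>. n (v + \<rho> * sin (2 * pi * \<phi>))) integrable_on {0..1}"
      by (intro integrable_continuous_real continuous_on_compose2[OF cont] continuous_intros) (use in_xy sub in auto)
    have h0: "h \<phi> \<ge> 0" for \<phi> using wmax[OF in_xy] by (simp add: h_def)
    have sin0: "((\<lambda>\<phi>. sin (2 * pi * \<phi>)) has_integral 0) {0..1}"
    proof -
      have "((\<lambda>\<phi>. sin (2 * pi * \<phi>)) has_integral (- cos (2 * pi * 1) / (2 * pi) - (- cos (2 * pi * 0) / (2 * pi)))) {0..1}"
        by (intro fundamental_theorem_of_calculus)
          (auto intro!: derivative_eq_intros simp: has_real_derivative_iff_has_vector_derivative[symmetric])
      then show ?thesis by simp
    qed
    have "integral {0..1} h = m w - (integral {0..1} (\<lambda>\<phi>. n (v + \<rho> * sin (2 * pi * \<phi>))) - (n x + k * (v - x)))"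
    proof -
      have 1: "(h has_integral (m w - (integral {0..1} (\<lambda>\<phi>. n (v + \<rho> * sin (2 * pi * \<phi>))) - ((n x + k * (v - x)) + k * \<rho> * 0)))) {0..1}"
      proof -
        have c1: "((\<lambda>\<phi>::real. c) has_integral c) {0..1}" for c :: real
          using has_integral_const_real[of c 0 1] by simp
        have "((\<lambda>\<phi>. m w - (n (v + \<rho> * sin (2 * pi * \<phi>)) - ((n x + k * (v - x)) + k * \<rho> * sin (2 * pi * \<phi>)))) has_integral
          (m w - (integral {0..1} (\<lambda>\<phi>. n (v + \<rho> * sin (2 * pi * \<phi>))) - ((n x + k * (v - x)) + k * \<rho> * 0)))) {0..1}"
          by (intro has_integral_diff has_integral_add c1 integrable_integral[OF cn] has_integral_mult_right sin0)
        then show ?thesis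
          by (rule has_integral_eq[rotated]) (simp add: h_def m_def algebra_simps)
      qed
      then show ?thesis by (simp add: integral_unique)
    qed
    also have "\<dots> \<le> m w - (n v - (n x + k * (v - x)))"
      using submean[OF \<rho>(1) order_trans[OF \<rho>(2) sub]] by simp
    also have "\<dots> = 0" using v by (simp add: Z_def m_def)
    finally have "integral {0..1} h \<le> 0" .
    moreover have "integral {0..1} h \<ge> 0"
      using ch h0 by (intro integral_nonneg integrable_continuous_real) auto
    ultimately have "integral (cbox 0 1) h = 0" by simp
    \<comment> \<open>At \<open>\<phi> = 3/4\<close> the circle is at its left end \<open>v - \<rho>\<close>.\<close>
    then have "h (3/4) = 0"
      using integral_eq_0_iff[of 0 1 h] ch h0 by (simp add: cbox_interval)
    moreover have "sin (2 * pi * (3/4)) = (-1::real)"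
    proof -
      have "2 * pi * (3/4) = 3/2 * pi" by simp
      then show ?thesis by (simp only: sin_3over2_pi)
    qed
    ultimately have "m (v - \<rho>) = m w" by (simp add: h_def)
    then have "v - \<rho> \<in> Z" using in_xy[of "- (pi/2)"] by (simp add: Z_def)
    from vmin[OF this] show False using \<rho> by simp
  qed
  moreover have "(1 - t) * x + t * y \<in> {x..y}"
  proof -
    have e: "(1 - t) * x + t * y = x + t * (y - x)" "(1 - t) * x + t * y = y - (1 - t) * (y - x)"
      by (simp_all add: algebra_simps)
    have "0 \<le> t * (y - x)" "0 \<le> (1 - t) * (y - x)"
      using t xy by (auto intro!: mult_nonneg_nonneg)
    then show ?thesis unfolding atLeastAtMost_iff using e by linarith
  qed
  ultimately have "m ((1 - t) * x + t * y) \<le> 0" by blast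
  moreover have "k * ((1 - t) * x + t * y - x) = t * (n y - n x)"
  proof -
    have "(1 - t) * x + t * y - x = t * (y - x)" by (simp add: algebra_simps)
    then show ?thesis using xy by (simp add: k_def)
  qed
  ultimately show "n ((1 - t) *\<^sub>R x + t *\<^sub>R y) \<le> (1 - t) * n x + t * n y"
    by (simp add: m_def algebra_simps)
qed (use J in auto)

section \<open>Uniform convexity\<close>

text \<open>
  The mean value theorem on the two halves of the interval, since the derivative of \<open>x powr p\<close> is strictly increasing.
\<close>

lemma powr_midpoint_less:
  fixes u v p :: real
  assumes "1 < p" "0 \<le> u" "u < v"
  shows "((u + v) / 2) powr p < (u powr p + v powr p) / 2"
proof -
  define m where "m = (u + v) / 2"
  have m: "u < m" "m < v" "m - u = v - m" "0 < v - m" using assms by (auto simp: m_def field_simps)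
  have c: "continuous_on {a..b} (\<lambda>x. x powr p)" if "0 \<le> a" for a b :: real
    using assms that by (intro continuous_on_powr' continuous_intros) auto
  have d: "((\<lambda>x. x powr p) has_derivative (\<lambda>h. (p * x powr (p - 1)) * h)) (at x)" if "0 < x" for x :: real
    using has_real_derivative_powr[OF that, of p] by (simp add: has_field_derivative_def)
  obtain x where x: "u < x" "x < m" "m powr p - u powr p = (p * x powr (p - 1)) * (m - u)"
    using mvt[OF m(1) c[OF assms(2)], of "\<lambda>x h. (p * x powr (p - 1)) * h"] d assms(2) by auto
  obtain y where y: "m < y" "y < v" "v powr p - m powr p = (p * y powr (p - 1)) * (v - m)"
    using mvt[OF m(2) c, of "\<lambda>x h. (p * x powr (p - 1)) * h"] d assms(2) m(1) by auto
  have "x powr (p - 1) < y powr (p - 1)"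
    using x y assms by (intro powr_less_mono2) auto
  then have "(p * x powr (p - 1)) * (v - m) < (p * y powr (p - 1)) * (v - m)"
    using m assms by (intro mult_strict_right_mono mult_strict_left_mono) auto
  then have "m powr p - u powr p < v powr p - m powr p"
    using x y m by simp
  then show ?thesis by (simp add: m_def)
qed

lemma cmod_midpoint_powr_less:
  fixes a b :: complex
  assumes "1 < p" "a \<noteq> b"
  shows "cmod ((a + b) / 2) powr p < (cmod a powr p + cmod b powr p) / 2"
proof (cases "cmod a = cmod b")
  case True
  have "(cmod (a + b))\<^sup>2 + (cmod (a - b))\<^sup>2 = 2 * (cmod a)\<^sup>2 + 2 * (cmod b)\<^sup>2"
    unfolding cmod_power2 by (simp add: power2_eq_square algebra_simps)
  moreover have "(cmod (a - b))\<^sup>2 > 0" using assms by simp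
  moreover have "(2 * cmod a)\<^sup>2 = 4 * (cmod a)\<^sup>2" "(cmod b)\<^sup>2 = (cmod a)\<^sup>2"
    using True by (simp_all add: power_mult_distrib)
  ultimately have "(cmod (a + b))\<^sup>2 < (2 * cmod a)\<^sup>2" by linarith
  then have "cmod (a + b) < 2 * cmod a" by (rule power2_less_imp_less) simp
  then have "cmod ((a + b) / 2) < cmod a" by (simp add: norm_divide)
  then have "cmod ((a + b) / 2) powr p < cmod a powr p"
    using assms by (intro powr_less_mono2) auto
  then show ?thesis using True by simp
next
  case False
  have "cmod ((a + b) / 2) \<le> (cmod a + cmod b) / 2"
    using norm_triangle_ineq[of a b] by (simp add: norm_divide)
  then have "cmod ((a + b) / 2) powr p \<le> ((cmod a + cmod b) / 2) powr p"
    using assms by (intro powr_mono2) auto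
  also have "\<dots> < (cmod a powr p + cmod b powr p) / 2"
    using powr_midpoint_less[OF assms(1), of "cmod a" "cmod b"] powr_midpoint_less[OF assms(1), of "cmod b" "cmod a"] False
    by (cases "cmod a < cmod b") (auto simp: add.commute)
  finally show ?thesis .
qed

lemma cmod_midpoint_powr_le:
  fixes a b :: complex
  assumes "1 < p"
  shows "cmod ((a + b) / 2) powr p \<le> (cmod a powr p + cmod b powr p) / 2"
  using cmod_midpoint_powr_less[OF assms, of a b] by (cases "a = b") auto

lemma cmod_diff_powr_le:
  fixes a b :: complex
  assumes "1 < p"
  shows "cmod (a - b) powr p \<le> 2 powr p * (cmod a powr p + cmod b powr p)"
proof -
  have "cmod (a - b) powr p = 2 powr p * (cmod ((a + (- b)) / 2) powr p)"
    by (simp add: norm_divide powr_divide)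
  also have "\<dots> \<le> 2 powr p * ((cmod a powr p + cmod (- b) powr p) / 2)"
    using cmod_midpoint_powr_le[OF assms, of a "- b"] by (intro mult_left_mono) auto
  also have "\<dots> \<le> 2 powr p * (cmod a powr p + cmod b powr p)"
    by (intro mult_left_mono) auto
  finally show ?thesis .
qed

text \<open>
  A pointwise form of the uniform convexity of \<open>L\<^sup>p\<close>. Rearranged, it says
  \<open>|a - b|\<^sup>p \<le> \<eta> (|a|\<^sup>p + |b|\<^sup>p) + C \<delta>\<close>, where \<open>\<delta> \<ge> 0\<close> is the defect in the midpoint inequality for \<open>|_|\<^sup>p\<close>. By
  homogeneity it suffices to treat \<open>|a|\<^sup>p + |b|\<^sup>p = 1\<close>. There \<open>\<delta>\<close> is bounded below on the compact set
  where \<open>|a - b|\<^sup>p \<ge> \<eta>\<close>, by strict convexity. The constants are such that the inequality can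
  be integrated term by term with nonnegative terms on both sides.
\<close>

lemma uniform_convexity_powr:
  assumes p: "1 < (p::real)" and \<eta>: "0 < \<eta>"
  obtains C where "0 \<le> C" and "\<And>a b :: complex. cmod (a - b) powr p + C * cmod ((a + b) / 2) powr p
    \<le> (\<eta> + C / 2) * (cmod a powr p + cmod b powr p)"
proof -
  define s where "s = (\<lambda>(a, b). cmod a powr p + cmod b powr p)"
  define \<delta> where "\<delta> = (\<lambda>(a, b). (cmod a powr p + cmod b powr p) / 2 - cmod ((a + b) / 2) powr p)"
  define dif where "dif = (\<lambda>(a, b). cmod (a - b) powr p)"
  define K where "K = {x. s x = 1} \<inter> {x. \<eta> \<le> dif x}"
  have cont: "continuous_on UNIV s" "continuous_on UNIV \<delta>" "continuous_on UNIV dif"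
    using p unfolding s_def \<delta>_def dif_def case_prod_unfold
    by (auto intro!: continuous_intros continuous_on_powr')
  have "closed K"
    unfolding K_def by (intro closed_Int closed_Collect_eq closed_Collect_le cont continuous_intros)
  have le1: "cmod a \<le> 1 \<and> cmod b \<le> 1" if "s (a, b) = 1" for a b
  proof -
    have "x \<le> 1" if "0 \<le> x" "x powr p \<le> 1" for x
    proof (rule ccontr)
      assume "\<not> x \<le> 1"
      then have "1 powr p < x powr p" using p by (intro powr_less_mono2) auto
      then show False using that by simp
    qed
    moreover have "cmod a powr p \<le> 1" "cmod b powr p \<le> 1"
      using that powr_ge_zero[of "cmod a" p] powr_ge_zero[of "cmod b" p] unfolding s_def case_prod_conv by linarith+
    ultimately show ?thesis by simp
  qed
  have "K \<subseteq> cball 0 1 \<times> cball 0 1"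
    using le1 by (auto simp: K_def)
  then have "bounded K" by (rule bounded_subset[OF bounded_Times[OF bounded_cball bounded_cball]])
  with \<open>closed K\<close> have "compact K" by (simp add: compact_eq_bounded_closed)
  have \<delta>0: "\<delta> x \<ge> 0" for x
    using cmod_midpoint_powr_le[OF p, of "fst x" "snd x"] by (simp add: \<delta>_def case_prod_unfold)
  have \<delta>K: "\<delta> x > 0" if "x \<in> K" for x
  proof -
    have "fst x \<noteq> snd x" using that \<eta> p by (auto simp: K_def dif_def case_prod_unfold)
    from cmod_midpoint_powr_less[OF p this] show ?thesis by (simp add: \<delta>_def case_prod_unfold)
  qed
  obtain m where m: "m > 0" "\<And>x. x \<in> K \<Longrightarrow> m \<le> \<delta> x"
  proof (cases "K = {}")
    case False
    then obtain x where "x \<in> K" "\<And>y. y \<in> K \<Longrightarrow> \<delta> x \<le> \<delta> y"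
      using continuous_attains_inf[OF \<open>compact K\<close> False continuous_on_subset[OF cont(2)]] by auto
    with \<delta>K that show ?thesis by blast
  qed (use that[of 1] in auto)
  define C where "C = 2 powr p / m"
  have C0: "C \<ge> 0" using m by (simp add: C_def)
  have norm1: "dif (a, b) \<le> \<eta> + C * \<delta> (a, b)" if "s (a, b) = 1" for a b
  proof (cases "(a, b) \<in> K")
    case True
    have "cmod (a - b) \<le> 2"
      using norm_triangle_ineq4[of a b] le1[OF that] by linarith
    then have "dif (a, b) \<le> 2 powr p"
      using p by (simp add: dif_def powr_mono2)
    also have "\<dots> = C * m" using m by (simp add: C_def)
    also have "\<dots> \<le> C * \<delta> (a, b)" using m True C0 by (intro mult_left_mono) auto
    finally show ?thesis using \<eta> by simp
  next
    case False
    then have "dif (a, b) < \<eta>" using that by (simp add: K_def)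
    then show ?thesis using C0 \<delta>0[of "(a, b)"] by (smt (verit) mult_nonneg_nonneg)
  qed
  have "dif (a, b) \<le> \<eta> * s (a, b) + C * \<delta> (a, b)" for a b
  proof (cases "s (a, b) = 0")
    case True
    then have "cmod a powr p = 0" "cmod b powr p = 0"
      using powr_ge_zero[of "cmod a" p] powr_ge_zero[of "cmod b" p] unfolding s_def case_prod_conv by linarith+
    then show ?thesis by (simp add: dif_def s_def \<delta>_def)
  next
    case False
    define r where "r = s (a, b) powr (1 / p)"
    have spos: "s (a, b) > 0" using False by (simp add: s_def less_le)
    then have r: "r > 0" "r powr p = s (a, b)" using p by (auto simp: r_def powr_powr)
    have sc: "cmod (x / of_real r) powr p = cmod x powr p / s (a, b)" for x
      using r by (simp add: norm_divide powr_divide)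
    have "s (a / of_real r, b / of_real r) = 1"
      using spos unfolding s_def case_prod_conv sc by (simp add: s_def add_divide_distrib[symmetric])
    note norm1[OF this]
    moreover have "dif (a / of_real r, b / of_real r) = dif (a, b) / s (a, b)"
      unfolding dif_def case_prod_conv diff_divide_distrib[symmetric] by (rule sc)
    moreover have "\<delta> (a / of_real r, b / of_real r) = \<delta> (a, b) / s (a, b)"
    proof -
      have "(a / of_real r + b / of_real r) / 2 = ((a + b) / 2) / of_real r"
        by (simp add: add_divide_distrib mult.commute)
      then show ?thesis
        unfolding \<delta>_def case_prod_conv by (simp only: sc) (simp add: diff_divide_distrib add_divide_distrib)
    qed
    ultimately have "dif (a, b) / s (a, b) \<le> \<eta> + C * (\<delta> (a, b) / s (a, b))" by simp
    then show ?thesis using spos by (simp add: field_simps)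
  qed
  then have "cmod (a - b) powr p + C * cmod ((a + b) / 2) powr p \<le> (\<eta> + C / 2) * (cmod a powr p + cmod b powr p)" for a b
    unfolding dif_def s_def \<delta>_def case_prod_conv by (simp add: algebra_simps add_divide_distrib)
  with C0 that show ?thesis by blast
qed

section \<open>Averaging along a flow\<close>

lemma holomorphic2_on_direction:
  fixes v :: "complex \<times> complex"
  assumes "(F has_derivative (\<lambda>(h, k). a * h + b * k)) (at (fst z + \<zeta> * fst v, snd z + \<zeta> * snd v))"
  shows "((\<lambda>\<zeta>. F (fst z + \<zeta> * fst v, snd z + \<zeta> * snd v)) has_field_derivative (a * fst v + b * snd v)) (at \<zeta>)"
proof -
  have "((\<lambda>\<zeta>. (fst z + \<zeta> * fst v, snd z + \<zeta> * snd v)) has_derivative (\<lambda>h. (h * fst v, h * snd v))) (at \<zeta>)"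
    by (auto intro!: derivative_eq_intros)
  from diff_chain_at[OF this assms] show ?thesis
    unfolding has_field_derivative_def o_def by (rule has_derivative_eq_rhs) (simp add: fun_eq_iff algebra_simps)
qed

text \<open>
  The directional derivative is locally a mean of \<open>F\<close> over circles of a fixed radius, and such a mean
  depends continuously on the centre. This gives the continuity of the derivative that is needed to differentiate under the
  integral sign.
\<close>

lemma holomorphic2_on_derivative_continuous:
  fixes v :: "complex \<times> complex"
  assumes F: "\<And>z. z \<in> U \<Longrightarrow> (F has_derivative (\<lambda>(h, k). a z * h + b z * k)) (at z)"
    and U: "open U" and v: "norm v = 1"
  shows "continuous_on U (\<lambda>z. a z * fst v + b z * snd v)"
  unfolding continuous_on_eq_continuous_at[OF U]
proof
  fix z0 assume "z0 \<in> U"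
  then obtain e where e: "0 < e" "ball z0 e \<subseteq> U" using U openE by blast
  define \<rho> where "\<rho> = e / 3"
  have \<rho>: "0 < \<rho>" using e by (simp add: \<rho>_def)
  have inU: "(fst z + \<zeta> * fst v, snd z + \<zeta> * snd v) \<in> U" if "z \<in> ball z0 \<rho>" "cmod \<zeta> \<le> \<rho>" for z \<zeta>
  proof -
    have "dist z (fst z + \<zeta> * fst v, snd z + \<zeta> * snd v) = norm (\<zeta> * fst v, \<zeta> * snd v)"
      by (simp add: dist_norm norm_prod_def)
    also have "\<dots> = cmod \<zeta> * norm v"
      by (simp add: norm_prod_def norm_mult power_mult_distrib distrib_left[symmetric] real_sqrt_mult)
    finally have "dist z (fst z + \<zeta> * fst v, snd z + \<zeta> * snd v) \<le> \<rho>" using that v by simp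
    then have "dist z0 (fst z + \<zeta> * fst v, snd z + \<zeta> * snd v) < e"
      using that(1) dist_triangle[of z0 "(fst z + \<zeta> * fst v, snd z + \<zeta> * snd v)" z] e(1) unfolding \<rho>_def mem_ball by linarith
    then show ?thesis using e by auto
  qed
  have contF: "continuous_on U F"
    using F by (meson continuous_at_imp_continuous_on has_derivative_continuous)
  have eq: "a z * fst v + b z * snd v = integral {0..1} (\<lambda>\<phi>. F (fst z + of_real \<rho> * cis (2 * pi * \<phi>) * fst v, snd z + of_real \<rho> * cis (2 * pi * \<phi>) * snd v) / (of_real \<rho> * cis (2 * pi * \<phi>)))"
    if z: "z \<in> ball z0 \<rho>" for z
  proof -
    let ?g = "\<lambda>\<zeta>. F (fst z + \<zeta> * fst v, snd z + \<zeta> * snd v)"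
    have d: "(?g has_field_derivative (a (fst z + \<zeta> * fst v, snd z + \<zeta> * snd v) * fst v + b (fst z + \<zeta> * fst v, snd z + \<zeta> * snd v) * snd v)) (at \<zeta>)"
      if "cmod \<zeta> \<le> \<rho>" for \<zeta>
      by (rule holomorphic2_on_direction) (rule F[OF inU[OF z that]])
    have "deriv ?g 0 = a z * fst v + b z * snd v"
      using DERIV_imp_deriv[OF d[of 0]] \<rho> by simp
    moreover have "continuous_on (cball 0 \<rho>) ?g"
      using DERIV_isCont[OF d] by (intro continuous_at_imp_continuous_on) auto
    moreover have "?g holomorphic_on ball 0 \<rho>"
      unfolding holomorphic_on_def field_differentiable_def
    proof
      fix \<zeta> :: complex assume "\<zeta> \<in> ball 0 \<rho>"
      then have "cmod \<zeta> \<le> \<rho>" by simp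
      from has_field_derivative_at_within[OF d[OF this]]
      show "\<exists>f'. (?g has_field_derivative f') (at \<zeta> within ball 0 \<rho>)" by (rule exI)
    qed
    ultimately show ?thesis using circle_mean_deriv[of \<rho> ?g] \<rho> by simp
  qed
  have "continuous_on (ball z0 \<rho>) (\<lambda>z. integral (cbox 0 1) (\<lambda>\<phi>. F (fst z + of_real \<rho> * cis (2 * pi * \<phi>) * fst v, snd z + of_real \<rho> * cis (2 * pi * \<phi>) * snd v) / (of_real \<rho> * cis (2 * pi * \<phi>))))"
    unfolding case_prod_unfold
    by (intro integral_continuous_on_param, unfold case_prod_unfold, intro continuous_intros continuous_on_compose2[OF contF])
      (use inU \<rho> in \<open>auto simp: norm_mult\<close>)
  then have "continuous_on (ball z0 \<rho>) (\<lambda>z. a z * fst v + b z * snd v)"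
    using eq by (subst continuous_on_cong[OF refl eq]) auto
  then show "isCont (\<lambda>z. a z * fst v + b z * snd v) z0"
    using \<rho> by (simp add: continuous_on_eq_continuous_at)
qed

definition avg :: "real \<Rightarrow> real \<Rightarrow> real \<Rightarrow> (complex \<times> complex \<Rightarrow> complex) \<Rightarrow> complex \<times> complex \<Rightarrow> complex"
  where "avg c d h F z = integral {0..1} (\<lambda>\<tau>. F (flow c d (of_real (h * \<tau>)) z))"

lemma holomorphic2_on_avg:
  assumes F: "F holomorphic2_on U" and U: "open U"
    and inv: "\<And>z \<tau>. z \<in> U \<Longrightarrow> flow c d (of_real \<tau>) z \<in> U"
  shows "avg c d h F holomorphic2_on U"
  unfolding holomorphic2_on_def
proof
  fix z0 assume "z0 \<in> U"
  then obtain r where r: "0 < r" "ball z0 r \<subseteq> U" using U openE by blast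
  have "\<forall>z\<in>U. \<exists>ab. (F has_derivative (\<lambda>(h, k). fst ab * h + snd ab * k)) (at z)"
    using F unfolding holomorphic2_on_def by (metis fst_conv snd_conv)
  then obtain ab where ab: "\<And>z. z \<in> U \<Longrightarrow> (F has_derivative (\<lambda>(h, k). fst (ab z) * h + snd (ab z) * k)) (at z)"
    by (metis (no_types))
  have ca: "continuous_on U (\<lambda>z. fst (ab z))" and cb: "continuous_on U (\<lambda>z. snd (ab z))"
    using holomorphic2_on_derivative_continuous[OF ab U, of "(1, 0)"] holomorphic2_on_derivative_continuous[OF ab U, of "(0, 1)"]
    by simp_all
  define A B where "A z \<tau> = fst (ab (flow c d (of_real (h * \<tau>)) z))"
    and "B z \<tau> = snd (ab (flow c d (of_real (h * \<tau>)) z)) * exp (- \<i> * of_real d * of_real (h * \<tau>))" for z \<tau>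
  have cA: "continuous_on (ball z0 r \<times> cbox 0 1) (\<lambda>x. A (fst x) (snd x))"
    unfolding A_def using r inv by (intro continuous_on_compose2[OF ca] continuous_intros) (auto simp del: of_real_mult)
  have cB: "continuous_on (ball z0 r \<times> cbox 0 1) (\<lambda>x. B (fst x) (snd x))"
    unfolding B_def using r inv by (intro continuous_intros continuous_on_compose2[OF cb]) (auto simp del: of_real_mult)
  define fx where "fx z \<tau> = (blinfun_mult_right (A z \<tau>) o\<^sub>L fst_blinfun) + (blinfun_mult_right (B z \<tau>) o\<^sub>L snd_blinfun)" for z \<tau>
  have fx: "blinfun_apply (fx z \<tau>) = (\<lambda>(h, k). A z \<tau> * h + B z \<tau> * k)" for z \<tau>
    by (auto simp: fx_def blinfun.bilinear_simps fun_eq_iff)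
  have der: "((\<lambda>z. F (flow c d (of_real (h * \<tau>)) z)) has_derivative blinfun_apply (fx z \<tau>)) (at z within ball z0 r)"
    if "z \<in> ball z0 r" for z \<tau>
  proof -
    have "flow c d (of_real (h * \<tau>)) z \<in> U" using that r by (intro inv) auto
    from has_derivative_compose_flow[OF ab[OF this]] show ?thesis
      unfolding fx A_def B_def by (rule has_derivative_at_withinI)
  qed
  have cfx: "continuous_on (ball z0 r \<times> cbox 0 1) (\<lambda>(z, \<tau>). fx z \<tau>)"
    unfolding fx_def case_prod_unfold
    by (intro continuous_on_add bounded_bilinear.continuous_on[OF bounded_bilinear_blinfun_compose] continuous_on_const
        bounded_linear.continuous_on[OF bounded_linear_blinfun_mult_right] cA cB)
  have cF: "continuous_on U F" using F by (rule holomorphic2_on_imp_continuous_on)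
  have int: "(\<lambda>\<tau>. F (flow c d (of_real (h * \<tau>)) z)) integrable_on cbox 0 1" if "z \<in> ball z0 r" for z
  proof -
    have "flow c d (of_real (h * \<tau>)) z \<in> U" for \<tau> using that r by (intro inv) auto
    then show ?thesis
      by (intro integrable_continuous continuous_on_compose2[OF cF] continuous_intros) (auto simp del: of_real_mult)
  qed
  have cp: "continuous_on X (Pair z0)" for X :: "real set"
    using continuous_on_Pair[OF continuous_on_const continuous_on_id, of X z0] by simp
  have cpi: "Pair z0 ` {0..1::real} \<subseteq> ball z0 r \<times> cbox 0 1"
    using r by (intro image_subsetI) simp
  have cz: "continuous_on (cbox 0 1) (fx z0)"
    using continuous_on_compose2[OF cfx cp cpi] by simp
  have "((\<lambda>z. integral (cbox 0 1) (\<lambda>\<tau>. F (flow c d (of_real (h * \<tau>)) z))) has_derivative blinfun_apply (integral (cbox 0 1) (fx z0))) (at z0 within ball z0 r)"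
    using r by (intro leibniz_rule der int cfx) auto
  then have "(avg c d h F has_derivative blinfun_apply (integral (cbox 0 1) (fx z0))) (at z0)"
    using r by (simp add: avg_def[abs_def] at_within_open[of z0 "ball z0 r"])
  moreover have "blinfun_apply (integral (cbox 0 1) (fx z0)) = (\<lambda>(h, k). integral {0..1} (A z0) * h + integral {0..1} (B z0) * k)"
  proof
    fix x :: "complex \<times> complex"
    have A: "A z0 integrable_on {0..1}" and B: "B z0 integrable_on {0..1}"
      using continuous_on_compose2[OF cA cp cpi] continuous_on_compose2[OF cB cp cpi]
      by (auto intro!: integrable_continuous_real)
    have "blinfun_apply (integral (cbox 0 1) (fx z0)) x = integral (cbox 0 1) (\<lambda>\<tau>. blinfun_apply (fx z0 \<tau>) x)"
      by (intro blinfun_apply_integral integrable_continuous cz)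
    also have "\<dots> = integral {0..1} (A z0) * fst x + integral {0..1} (B z0) * snd x"
      unfolding fx case_prod_unfold
      using has_integral_add[OF has_integral_mult_left[OF integrable_integral[OF A], of "fst x"] has_integral_mult_left[OF integrable_integral[OF B], of "snd x"]]
      by (simp add: integral_unique)
    finally show "blinfun_apply (integral (cbox 0 1) (fx z0)) x = (\<lambda>(h, k). integral {0..1} (A z0) * h + integral {0..1} (B z0) * k) x"
      by (simp add: case_prod_unfold)
  qed
  ultimately show "\<exists>a b. (avg c d h F has_derivative (\<lambda>(h, k). a * h + b * k)) (at z0)"
    by auto
qed

lemma nn_integral_unit_scale:
  fixes g :: "real \<Rightarrow> ennreal"
  assumes [measurable]: "g \<in> borel_measurable borel" and h: "0 < h"
  shows "(\<integral>\<^sup>+\<tau>. g (x + h * \<tau>) \<partial>unit_measure) = ennreal (1 / h) * (\<integral>\<^sup>+s. g s * indicator {x..x + h} s \<partial>lborel)"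
proof -
  have "(\<integral>\<^sup>+s. g s * indicator {x..x + h} s \<partial>lborel) =
      ennreal h * (\<integral>\<^sup>+\<tau>. g (x + h * \<tau>) * indicator {x..x + h} (x + h * \<tau>) \<partial>lborel)"
    using h by (subst nn_integral_real_affine[of _ h x]) auto
  also have "(\<integral>\<^sup>+\<tau>. g (x + h * \<tau>) * indicator {x..x + h} (x + h * \<tau>) \<partial>lborel) =
      (\<integral>\<^sup>+\<tau>. g (x + h * \<tau>) * indicator {0..1} \<tau> \<partial>lborel)"
    using h by (intro nn_integral_cong) (auto simp: indicator_def zero_le_mult_iff)
  also have "\<dots> = (\<integral>\<^sup>+\<tau>. g (x + h * \<tau>) \<partial>unit_measure)"
    by (rule nn_integral_unit) measurable
  finally show ?thesis
    using h by (simp add: mult.assoc[symmetric] ennreal_mult[symmetric])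
qed

text \<open>
  The derivative of the average is the average of the derivative, and the latter is computed by the
  fundamental theorem of calculus.
\<close>

lemma average_along_line_has_derivative:
  fixes g :: "complex \<Rightarrow> complex"
  assumes g: "g holomorphic_on W" and W: "open W" "\<And>\<zeta> s. \<zeta> \<in> W \<Longrightarrow> \<zeta> + of_real s \<in> W"
    and h: "h \<noteq> 0" and \<zeta>: "\<zeta> \<in> W"
  shows "((\<lambda>\<zeta>. integral {0..1} (\<lambda>\<tau>. g (\<zeta> + of_real (h * \<tau>)))) has_field_derivative
    (g (\<zeta> + of_real h) - g \<zeta>) / of_real h) (at \<zeta>)"
proof -
  obtain r where r: "0 < r" "ball \<zeta> r \<subseteq> W" using W(1) \<zeta> openE by blast
  have d: "(g has_field_derivative deriv g w) (at w)" if "w \<in> W" for w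
    using g W(1) that by (rule holomorphic_derivI)
  have cg: "continuous_on W g" using g by (rule holomorphic_on_imp_continuous_on)
  have cd: "continuous_on W (deriv g)"
    using holomorphic_deriv[OF g W(1)] by (rule holomorphic_on_imp_continuous_on)
  have inW: "w + of_real (h * \<tau>) \<in> W" if "w \<in> ball \<zeta> r" for w \<tau>
    using that r by (intro W) auto
  have "((\<lambda>w. integral (cbox 0 1) (\<lambda>\<tau>. g (w + of_real (h * \<tau>)))) has_field_derivative
      integral (cbox 0 1) (\<lambda>\<tau>. deriv g (\<zeta> + of_real (h * \<tau>)))) (at \<zeta> within ball \<zeta> r)"
  proof (rule leibniz_rule_field_derivative)
    fix w :: complex and \<tau> :: real assume w: "w \<in> ball \<zeta> r"
    have "((\<lambda>w. w + of_real (h * \<tau>)) has_field_derivative 1) (at w)"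
      by (auto intro!: derivative_eq_intros)
    from DERIV_chain2[where f = g, OF d[OF inW[OF w, of \<tau>]] this]
    show "((\<lambda>w. g (w + of_real (h * \<tau>))) has_field_derivative deriv g (w + of_real (h * \<tau>))) (at w within ball \<zeta> r)"
      unfolding mult_1_right by (rule has_field_derivative_at_within)
  next
    fix w assume w: "w \<in> ball \<zeta> r"
    show "(\<lambda>\<tau>. g (w + of_real (h * \<tau>))) integrable_on cbox 0 1"
      using inW[OF w] by (intro integrable_continuous continuous_on_compose2[OF cg] continuous_intros) (auto simp del: of_real_mult)
  next
    show "continuous_on (ball \<zeta> r \<times> cbox 0 1) (\<lambda>(w, \<tau>). deriv g (w + of_real (h * \<tau>)))"
      unfolding case_prod_unfold using inW
      by (intro continuous_on_compose2[OF cd] continuous_intros) (auto simp del: of_real_mult)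
  qed (use r in auto)
  moreover have "((\<lambda>\<tau>. deriv g (\<zeta> + of_real (h * \<tau>))) has_integral
      (g (\<zeta> + of_real (h * 1)) / of_real h - g (\<zeta> + of_real (h * 0)) / of_real h)) {0..1}"
  proof (rule fundamental_theorem_of_calculus)
    fix \<tau> :: real
    have "((\<lambda>u::complex. \<zeta> + of_real h * u) has_field_derivative of_real h) (at (of_real \<tau>))"
      by (auto intro!: derivative_eq_intros)
    moreover have "(g has_field_derivative deriv g (\<zeta> + of_real h * of_real \<tau>)) (at (\<zeta> + of_real h * of_real \<tau>))"
      using d[OF W(2)[OF \<zeta>, of "h * \<tau>"]] by simp
    ultimately have "((\<lambda>u::complex. g (\<zeta> + of_real h * u) / of_real h) has_field_derivative deriv g (\<zeta> + of_real h * of_real \<tau>) * of_real h / of_real h) (at (of_real \<tau>))"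
      by (intro DERIV_cdivide DERIV_chain2)
    then have "((\<lambda>u::complex. g (\<zeta> + of_real h * u) / of_real h) has_field_derivative deriv g (\<zeta> + of_real h * of_real \<tau>)) (at (of_real \<tau>))"
      using h by simp
    from has_vector_derivative_real_field[OF this]
    show "((\<lambda>\<tau>. g (\<zeta> + of_real (h * \<tau>)) / of_real h) has_vector_derivative deriv g (\<zeta> + of_real (h * \<tau>))) (at \<tau> within {0..1})"
      by (simp add: has_vector_derivative_at_within)
  qed simp
  ultimately show ?thesis
    using r by (simp add: integral_unique diff_divide_distrib at_within_open[of \<zeta> "ball \<zeta> r"])
qed

section \<open>Convexity of the slice norms\<close>

locale hardy_domain =
  fixes \<beta> p :: real
  assumes \<beta>: "pi / 2 < \<beta>" and p: "1 < p"
begin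

definition rect :: "(real \<times> real) set"
  where "rect = {- (pi / 2)<..<pi / 2} \<times> {- (\<beta> - pi / 2)<..<\<beta> - pi / 2}"

definition mean_power :: "(complex \<times> complex \<Rightarrow> complex) \<Rightarrow> real \<Rightarrow> real \<Rightarrow> ennreal"
  where "mean_power F t l = (\<integral>\<^sup>+\<omega>. ennreal (cmod (F (tube_pt t l \<omega>)) powr p) \<partial>cyl_measure)"

lemma open_rect: "open rect" and convex_rect: "convex rect"
  unfolding rect_def by (auto intro!: open_Times convex_Times)

lemma rect_iff: "(t, l) \<in> rect \<longleftrightarrow> \<bar>t\<bar> < pi / 2 \<and> \<bar>l\<bar> < \<beta> - pi / 2"
  unfolding rect_def by (simp add: abs_less_iff) linarith

lemma tube_pt_in_D' [simp]: "tube_pt t l \<omega> \<in> D' \<beta> \<longleftrightarrow> (t, l) \<in> rect"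
proof -
  have "ln ((cmod (complex_of_real (exp (l / 2)) * cis (2 * pi * snd \<omega>)))\<^sup>2) = l"
    by (simp add: norm_mult exp_double[symmetric])
  then show ?thesis
    unfolding D'_def tube_pt_def rect_iff mem_Collect_eq case_prod_conv by simp
qed

lemma D'_cases:
  assumes "z \<in> D' \<beta>"
  obtains t l \<omega> where "z = tube_pt t l \<omega>" "(t, l) \<in> rect"
proof -
  define l where "l = ln ((cmod (snd z))\<^sup>2)"
  define t where "t = Im (fst z) - l"
  define \<omega> where "\<omega> = (Re (fst z), Arg (snd z) / (2 * pi))"
  have nz: "snd z \<noteq> 0" using assms by (auto simp: D'_def)
  have "exp (l / 2) = cmod (snd z)"
    using nz by (simp add: l_def ln_realpow)
  moreover have "snd z = of_real (cmod (snd z)) * cis (Arg (snd z))"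
    using rcis_cmod_Arg[of "snd z"] by (simp add: rcis_def)
  ultimately have "z = tube_pt t l \<omega>"
    by (simp add: tube_pt_def prod_eq_iff complex_eq_iff[of "fst z"] t_def \<omega>_def)
  then show ?thesis using assms that by auto
qed

lemma flow_real_in_D' [simp]: "flow c d (of_real \<tau>) z \<in> D' \<beta> \<longleftrightarrow> z \<in> D' \<beta>"
proof -
  have 1: "flow c d (of_real \<tau>) z \<in> D' \<beta>" if "z \<in> D' \<beta>" for \<tau> z
    using that by (rule D'_cases) (simp add: flow_tube_pt)
  have "flow c d (of_real (- \<tau>)) (flow c d (of_real \<tau>) z) = z"
    unfolding flow_flow by simp
  then show ?thesis using 1[of z] 1[of "flow c d (of_real \<tau>) z" "- \<tau>"] by auto
qed

lemma open_D': "open (D' \<beta>)"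
proof -
  have o: "open {z :: complex \<times> complex. snd z \<noteq> 0}"
    by (intro open_Collect_neq continuous_intros)
  have c: "continuous_on {z. snd z \<noteq> 0} (\<lambda>z :: complex \<times> complex. (Im (fst z) - ln ((cmod (snd z))\<^sup>2), ln ((cmod (snd z))\<^sup>2)))"
    by (intro continuous_intros) auto
  have "D' \<beta> = {z. snd z \<noteq> 0} \<inter> (\<lambda>z. (Im (fst z) - ln ((cmod (snd z))\<^sup>2), ln ((cmod (snd z))\<^sup>2))) -` rect"
    by (auto simp: D'_def rect_iff )
  then show ?thesis using continuous_open_preimage[OF c o open_rect] by simp
qed

lemma borel_measurable_power_comp:
  assumes "continuous_on (D' \<beta>) H" "continuous_on UNIV g" "\<And>x. g x \<in> D' \<beta>"
  shows "(\<lambda>x. ennreal (cmod (H (g x)) powr p)) \<in> borel_measurable borel"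
proof -
  have "continuous_on UNIV (\<lambda>x. H (g x))"
    using assms by (intro continuous_on_compose2[OF assms(1)]) auto
  then show ?thesis
    using p by (intro measurable_compose[OF _ measurable_ennreal] borel_measurable_continuous_onI
        continuous_on_powr' continuous_intros) auto
qed

lemma measurable_mean_power:
  assumes "continuous_on (D' \<beta>) H" "(t, l) \<in> rect"
  shows "(\<lambda>\<omega>. ennreal (cmod (H (tube_pt t l \<omega>)) powr p)) \<in> borel_measurable borel"
  using assms by (intro borel_measurable_power_comp continuous_intros) auto

text \<open>
  The iterated integral in \<^const>\<open>slice_integral\<close> becomes one integral over the cylinder, in the
  coordinates of the rectangle.
\<close>

lemma slice_integral_eq_mean_power:
  assumes "continuous_on (D' \<beta>) H" "(t, l) \<in> rect"
  shows "slice_integral p H (t + l) (exp (l / 2)) = mean_power H t l"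
proof -
  note m = measurable_mean_power[OF assms]
  have "(\<lambda>\<theta>. ennreal (cmod (H (tube_pt t l (x, \<theta>))) powr p)) \<in> borel_measurable borel" for x
    using assms by (intro borel_measurable_power_comp continuous_intros) auto
  then have "slice_integral p H (t + l) (exp (l / 2)) =
      (\<integral>\<^sup>+x. (\<integral>\<^sup>+\<theta>. ennreal (cmod (H (tube_pt t l (x, \<theta>))) powr p) \<partial>unit_measure) \<partial>lborel)"
    by (simp add: slice_integral_def tube_pt_def nn_integral_unit)
  also have "\<dots> = mean_power H t l"
    unfolding mean_power_def by (rule unit.nn_integral_fst) (rule borel_measurable_cyl[OF m])
  finally show ?thesis .
qed

text \<open>
  The real part of \<open>\<zeta>\<close> only shifts the cylinder, so the slice norm after the flow depends on \<open>Im \<zeta>\<close> alone.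
\<close>

lemma mean_power_flow:
  assumes "continuous_on (D' \<beta>) H" "(t + (c - 2 * d) * Im \<zeta>, l + 2 * d * Im \<zeta>) \<in> rect"
  shows "(\<integral>\<^sup>+\<omega>. ennreal (cmod (H (flow c d \<zeta> (tube_pt t l \<omega>))) powr p) \<partial>cyl_measure) =
    mean_power H (t + (c - 2 * d) * Im \<zeta>) (l + 2 * d * Im \<zeta>)"
  using nn_integral_cyl_shift[OF measurable_mean_power[OF assms], of "c * Re \<zeta>" "- d * Re \<zeta> / (2 * pi)"]
  by (simp add: flow_tube_pt mean_power_def)

lemma holomorphic_along_flow:
  assumes H: "H holomorphic2_on D' \<beta>"
    and J: "\<And>\<eta>. \<bar>\<eta>\<bar> \<le> \<rho> \<Longrightarrow> (t + (c - 2 * d) * \<eta>, l + 2 * d * \<eta>) \<in> rect"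
  shows "continuous_on (cball 0 \<rho>) (\<lambda>\<zeta>. H (flow c d \<zeta> (tube_pt t l \<omega>)))"
    and "(\<lambda>\<zeta>. H (flow c d \<zeta> (tube_pt t l \<omega>))) holomorphic_on ball 0 \<rho>"
proof -
  have "flow c d \<zeta> (tube_pt t l \<omega>) \<in> D' \<beta>" if "cmod \<zeta> \<le> \<rho>" for \<zeta>
    using J[of "Im \<zeta>"] abs_Im_le_cmod[of \<zeta>] that by (simp add: flow_tube_pt)
  then have "(\<lambda>\<zeta>. H (flow c d \<zeta> (tube_pt t l \<omega>))) field_differentiable at \<zeta>" if "cmod \<zeta> \<le> \<rho>" for \<zeta>
    using that field_differentiable_along_flow[OF H] by blast
  then show "continuous_on (cball 0 \<rho>) (\<lambda>\<zeta>. H (flow c d \<zeta> (tube_pt t l \<omega>)))"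
    "(\<lambda>\<zeta>. H (flow c d \<zeta> (tube_pt t l \<omega>))) holomorphic_on ball 0 \<rho>"
    by (auto intro!: continuous_at_imp_continuous_on field_differentiable_imp_continuous_at
        simp: holomorphic_on_def field_differentiable_at_within)
qed

text \<open>
  Tonelli: a mean over circles at every point of a slice turns into a mean of slice norms along a line
  of the rectangle.
\<close>

lemma nn_integral_circle_flow:
  assumes H: "H holomorphic2_on D' \<beta>"
    and J: "\<And>\<eta>. \<bar>\<eta>\<bar> \<le> \<rho> \<Longrightarrow> (t + (c - 2 * d) * \<eta>, l + 2 * d * \<eta>) \<in> rect" and "0 < \<rho>"
  shows "(\<integral>\<^sup>+\<omega>. (\<integral>\<^sup>+\<phi>. ennreal (cmod (H (flow c d (of_real \<rho> * cis (2 * pi * \<phi>)) (tube_pt t l \<omega>))) powr p) \<partial>unit_measure) \<partial>cyl_measure)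
    = (\<integral>\<^sup>+\<phi>. mean_power H (t + (c - 2 * d) * (\<rho> * sin (2 * pi * \<phi>))) (l + 2 * d * (\<rho> * sin (2 * pi * \<phi>))) \<partial>unit_measure)"
    (is "?L = ?R")
    and "(\<lambda>\<omega>. (\<integral>\<^sup>+\<phi>. ennreal (cmod (H (flow c d (of_real \<rho> * cis (2 * pi * \<phi>)) (tube_pt t l \<omega>))) powr p) \<partial>unit_measure))
      \<in> borel_measurable cyl_measure"
proof -
  have contH: "continuous_on (D' \<beta>) H"
    using H by (rule holomorphic2_on_imp_continuous_on)
  have inr: "(t + (c - 2 * d) * (\<rho> * sin a), l + 2 * d * (\<rho> * sin a)) \<in> rect" for a
    using \<open>0 < \<rho>\<close> by (intro J) (simp add: abs_mult mult_left_le)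
  have "(\<lambda>x. ennreal (cmod (H (flow c d (of_real \<rho> * cis (2 * pi * snd x)) (tube_pt t l (fst x)))) powr p)) \<in> borel_measurable borel"
    using inr by (intro borel_measurable_power_comp contH continuous_intros) (auto simp: flow_tube_pt)
  then have m: "(\<lambda>x. ennreal (cmod (H (flow c d (of_real \<rho> * cis (2 * pi * snd x)) (tube_pt t l (fst x)))) powr p))
      \<in> borel_measurable (cyl_measure \<Otimes>\<^sub>M unit_measure)"
    using measurable_cong_sets[OF sets_cyl_unit refl] by blast
  show "(\<lambda>\<omega>. (\<integral>\<^sup>+\<phi>. ennreal (cmod (H (flow c d (of_real \<rho> * cis (2 * pi * \<phi>)) (tube_pt t l \<omega>))) powr p) \<partial>unit_measure))
      \<in> borel_measurable cyl_measure"
    using unit.borel_measurable_nn_integral_fst[OF m] by simp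
  have "?L = (\<integral>\<^sup>+\<phi>. (\<integral>\<^sup>+\<omega>. ennreal (cmod (H (flow c d (of_real \<rho> * cis (2 * pi * \<phi>)) (tube_pt t l \<omega>))) powr p) \<partial>cyl_measure) \<partial>unit_measure)"
    using cyl_unit.Fubini[OF m] by simp
  also have "\<dots> = ?R"
  proof (intro nn_integral_cong)
    fix \<phi>
    have "Im (of_real \<rho> * cis (2 * pi * \<phi>)) = \<rho> * sin (2 * pi * \<phi>)" by simp
    then show "(\<integral>\<^sup>+\<omega>. ennreal (cmod (H (flow c d (of_real \<rho> * cis (2 * pi * \<phi>)) (tube_pt t l \<omega>))) powr p) \<partial>cyl_measure)
       = mean_power H (t + (c - 2 * d) * (\<rho> * sin (2 * pi * \<phi>))) (l + 2 * d * (\<rho> * sin (2 * pi * \<phi>)))"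
      using inr[of "2 * pi * \<phi>"] mean_power_flow[OF contH, of t c d "of_real \<rho> * cis (2 * pi * \<phi>)" l] by simp
  qed
  finally show "?L = ?R" .
qed

lemma mean_power_submean:
  assumes H: "H holomorphic2_on D' \<beta>"
    and J: "\<And>\<eta>. \<bar>\<eta>\<bar> \<le> \<rho> \<Longrightarrow> (t + (c - 2 * d) * \<eta>, l + 2 * d * \<eta>) \<in> rect" and "0 < \<rho>"
  shows "mean_power H t l \<le>
    (\<integral>\<^sup>+\<phi>. mean_power H (t + (c - 2 * d) * (\<rho> * sin (2 * pi * \<phi>))) (l + 2 * d * (\<rho> * sin (2 * pi * \<phi>))) \<partial>unit_measure)"
proof -
  have "mean_power H t l \<le> (\<integral>\<^sup>+\<omega>. (\<integral>\<^sup>+\<phi>. ennreal (cmod (H (flow c d (of_real \<rho> * cis (2 * pi * \<phi>)) (tube_pt t l \<omega>))) powr p) \<partial>unit_measure) \<partial>cyl_measure)"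
    unfolding mean_power_def
    using circle_power_mean[OF holomorphic_along_flow[OF H J] \<open>0 < \<rho>\<close> p]
    by (intro nn_integral_mono) simp
  then show ?thesis
    using nn_integral_circle_flow(1)[OF H J \<open>0 < \<rho>\<close>] by simp
qed

text \<open>
  The bound is on the \<open>p\<close>-th power of the norm. Up to a factor 4 this is a bound on \<^const>\<open>hardy_sup\<close>.
\<close>

definition hardy_bounded :: "(complex \<times> complex \<Rightarrow> complex) \<Rightarrow> real \<Rightarrow> bool"
  where "hardy_bounded H B \<longleftrightarrow> (\<forall>(t, l)\<in>rect. mean_power H t l \<le> ennreal B)"

lemma hardy_boundedD: "hardy_bounded H B \<Longrightarrow> (t, l) \<in> rect \<Longrightarrow> mean_power H t l \<le> ennreal B"
  by (auto simp: hardy_bounded_def)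

lemma hardy_bounded_mono: "hardy_bounded H B \<Longrightarrow> B \<le> B' \<Longrightarrow> hardy_bounded H B'"
  unfolding hardy_bounded_def using ennreal_leI[of B B'] by (auto intro: order_trans)

text \<open>
  Dominated convergence; the majorant \<open>E\<close> is a mean over a circle around the base point, and
  its integral is finite because all slice norms are bounded.
\<close>

lemma mean_power_tendsto:
  assumes H: "H holomorphic2_on D' \<beta>" "hardy_bounded H B" and "(t, l) \<in> rect" and u: "u \<longlonglongrightarrow> 0"
  shows "(\<lambda>n. mean_power H (t + (c - 2 * d) * u n) (l + 2 * d * u n)) \<longlonglongrightarrow> mean_power H t l"
proof -
  have contH: "continuous_on (D' \<beta>) H"
    using H(1) by (rule holomorphic2_on_imp_continuous_on)
  have "open ((\<lambda>\<eta>. (t + (c - 2 * d) * \<eta>, l + 2 * d * \<eta>)) -` rect)"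
    by (intro open_vimage open_rect continuous_intros)
  then obtain \<rho> where \<rho>: "0 < \<rho>" "cball 0 \<rho> \<subseteq> (\<lambda>\<eta>. (t + (c - 2 * d) * \<eta>, l + 2 * d * \<eta>)) -` rect"
    using \<open>(t, l) \<in> rect\<close> open_contains_cball by (metis (no_types, lifting) add_0_right mult_zero_right vimageI)
  have J: "(t + (c - 2 * d) * \<eta>, l + 2 * d * \<eta>) \<in> rect" if "\<bar>\<eta>\<bar> \<le> \<rho>" for \<eta>
    using \<rho>(2) that by (auto simp: subset_iff)
  obtain N where N: "\<And>n. n \<ge> N \<Longrightarrow> \<bar>u n\<bar> < \<rho> / 2"
    using LIMSEQ_D[OF u, of "\<rho> / 2"] \<rho>(1) by auto
  define v where "v n = u (n + N)" for n
  have v: "\<bar>v n\<bar> \<le> \<rho> / 2" for n using N[of "n + N"] by (simp add: v_def)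
  have v0: "v \<longlonglongrightarrow> 0" unfolding v_def using u by (rule LIMSEQ_ignore_initial_segment)
  have vr: "(t + (c - 2 * d) * v n, l + 2 * d * v n) \<in> rect" for n
    using v[of n] \<rho>(1) by (intro J) auto
  define E where "E \<omega> = ennreal (2 powr p) * (\<integral>\<^sup>+\<phi>. ennreal (cmod (H (flow c d (of_real \<rho> * cis (2 * pi * \<phi>)) (tube_pt t l \<omega>))) powr p) \<partial>unit_measure)" for \<omega>
  note circ = nn_integral_circle_flow[OF H(1) J \<rho>(1)]
  have "(\<lambda>n. mean_power H (t + (c - 2 * d) * v n) (l + 2 * d * v n)) \<longlonglongrightarrow> mean_power H t l"
    unfolding mean_power_def
  proof (rule nn_integral_dominated_convergence[where w = E])
    show "E \<in> borel_measurable cyl_measure"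
      unfolding E_def using circ(2) by measurable
    show "(\<lambda>\<omega>. ennreal (cmod (H (tube_pt (t + (c - 2 * d) * v n) (l + 2 * d * v n) \<omega>)) powr p)) \<in> borel_measurable cyl_measure" for n
      by (intro borel_measurable_cyl measurable_mean_power contH vr)
    show "(\<lambda>\<omega>. ennreal (cmod (H (tube_pt t l \<omega>)) powr p)) \<in> borel_measurable cyl_measure"
      by (intro borel_measurable_cyl measurable_mean_power contH assms)
    show "AE \<omega> in cyl_measure. ennreal (cmod (H (tube_pt (t + (c - 2 * d) * v n) (l + 2 * d * v n) \<omega>)) powr p) \<le> E \<omega>" for n
    proof (rule AE_I2)
      fix \<omega>
      have f: "flow c d (\<i> * of_real (v n)) (tube_pt t l \<omega>) = tube_pt (t + (c - 2 * d) * v n) (l + 2 * d * v n) \<omega>"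
        by (simp add: flow_tube_pt)
      have "cmod (\<i> * of_real (v n)) \<le> \<rho> / 2" using v[of n] by (simp add: norm_mult)
      from circle_power_bound[OF holomorphic_along_flow[OF H(1) J] \<rho>(1) p this, of \<omega>]
      show "ennreal (cmod (H (tube_pt (t + (c - 2 * d) * v n) (l + 2 * d * v n) \<omega>)) powr p) \<le> E \<omega>"
        unfolding E_def f .
    qed
    have "(\<integral>\<^sup>+\<omega>. E \<omega> \<partial>cyl_measure) = ennreal (2 powr p) *
       (\<integral>\<^sup>+\<phi>. mean_power H (t + (c - 2 * d) * (\<rho> * sin (2 * pi * \<phi>))) (l + 2 * d * (\<rho> * sin (2 * pi * \<phi>))) \<partial>unit_measure)"
      unfolding E_def using nn_integral_cmult[OF circ(2), of "ennreal (2 powr p)"] circ(1) by simp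
    also have "\<dots> \<le> ennreal (2 powr p) * (\<integral>\<^sup>+\<phi>. ennreal B \<partial>unit_measure)"
      using \<rho>(1) by (intro mult_left_mono nn_integral_mono hardy_boundedD[OF H(2)] J)
        (auto simp: abs_mult mult_left_le)
    also have "\<dots> < \<infinity>" unfolding nn_integral_const_unit by (simp add: ennreal_mult_less_top)
    finally show "(\<integral>\<^sup>+\<omega>. E \<omega> \<partial>cyl_measure) < \<infinity>" .
    show "AE \<omega> in cyl_measure. (\<lambda>n. ennreal (cmod (H (tube_pt (t + (c - 2 * d) * v n) (l + 2 * d * v n) \<omega>)) powr p)) \<longlonglongrightarrow> ennreal (cmod (H (tube_pt t l \<omega>)) powr p)"
    proof (rule AE_I2)
      fix \<omega>
      have "isCont (\<lambda>s. tube_pt (t + (c - 2 * d) * s) (l + 2 * d * s) \<omega>) 0"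
        using continuous_on_eq_continuous_at[OF open_UNIV, of "\<lambda>s. tube_pt (t + (c - 2 * d) * s) (l + 2 * d * s) \<omega>"]
        by (auto intro!: continuous_intros)
      from isCont_tendsto_compose[OF this v0]
      have 1: "(\<lambda>n. tube_pt (t + (c - 2 * d) * v n) (l + 2 * d * v n) \<omega>) \<longlonglongrightarrow> tube_pt t l \<omega>" by simp
      have "isCont H (tube_pt t l \<omega>)"
        using contH open_D' assms(3) by (simp add: continuous_on_eq_continuous_at)
      from isCont_tendsto_compose[OF this 1] p
      show "(\<lambda>n. ennreal (cmod (H (tube_pt (t + (c - 2 * d) * v n) (l + 2 * d * v n) \<omega>)) powr p)) \<longlonglongrightarrow> ennreal (cmod (H (tube_pt t l \<omega>)) powr p)"
        by (intro tendsto_ennrealI tendsto_powr' tendsto_norm) auto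
    qed
  qed
  then show ?thesis unfolding v_def by (rule LIMSEQ_offset)
qed

text \<open>
  On every line the slice norm is continuous and satisfies the sub-mean value inequality.
\<close>

lemma mean_power_convex:
  assumes H: "H holomorphic2_on D' \<beta>" "hardy_bounded H B"
  shows "convex_on {u. (t + v1 * u, l + v2 * u) \<in> rect} (\<lambda>u. enn2real (mean_power H (t + v1 * u) (l + v2 * u)))"
    (is "convex_on ?J ?n")
proof -
  \<comment> \<open>The flow whose complex times move \<open>(t, l)\<close> in the direction \<open>(v1, v2)\<close>.\<close>
  define c d where "c = v1 + v2" and "d = v2 / 2"
  have v: "v1 = c - 2 * d" "v2 = 2 * d" by (auto simp: c_def d_def)
  have fin: "mean_power H t l < top" if "(t, l) \<in> rect" for t l
    using hardy_boundedD[OF H(2) that] by (rule order_le_less_trans) simp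
  have "?J = (\<lambda>u. (t + v1 * u, l + v2 * u)) -` rect" by auto
  moreover have "open ((\<lambda>u. (t + v1 * u, l + v2 * u)) -` rect)"
    by (intro open_vimage open_rect continuous_intros)
  ultimately have oJ: "open ?J" by simp
  have cJ: "convex ?J"
  proof (rule convexI)
    fix x y a b :: real assume "x \<in> ?J" "y \<in> ?J" and ab: "0 \<le> a" "0 \<le> b" "a + b = 1"
    then have "a *\<^sub>R (t + v1 * x, l + v2 * x) + b *\<^sub>R (t + v1 * y, l + v2 * y) \<in> rect"
      using convex_rect by (intro convexD) auto
    moreover have "a *\<^sub>R (t + v1 * x, l + v2 * x) + b *\<^sub>R (t + v1 * y, l + v2 * y) =
        ((a + b) * t + v1 * (a * x + b * y), (a + b) * l + v2 * (a * x + b * y))"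
      by (simp add: algebra_simps)
    ultimately show "a *\<^sub>R x + b *\<^sub>R y \<in> ?J" using ab by simp
  qed
  have cont: "continuous_on ?J ?n"
  proof (rule continuous_on_sequentiallyI)
    fix u a assume u: "\<forall>n. u n \<in> ?J" "a \<in> ?J" "u \<longlonglongrightarrow> a"
    have "(\<lambda>n. u n - a) \<longlonglongrightarrow> 0" using u(3) by (simp add: LIM_zero)
    from mean_power_tendsto[OF H _ this, of "t + v1 * a" "l + v2 * a" c d] u(2)
    have "(\<lambda>n. mean_power H (t + v1 * u n) (l + v2 * u n)) \<longlonglongrightarrow> mean_power H (t + v1 * a) (l + v2 * a)"
      by (simp add: v algebra_simps)
    then show "(\<lambda>n. ?n (u n)) \<longlonglongrightarrow> ?n a"
      using u(2) fin[of "t + v1 * a" "l + v2 * a"] by (intro tendsto_enn2real) simp_all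
  qed
  show ?thesis
  proof (rule submean_imp_convex[OF oJ cJ cont])
    fix x \<rho> :: real assume \<rho>: "0 < \<rho>" "{x - \<rho>..x + \<rho>} \<subseteq> ?J"
    have J: "(t + v1 * x + (c - 2 * d) * \<eta>, l + v2 * x + 2 * d * \<eta>) \<in> rect" if "\<bar>\<eta>\<bar> \<le> \<rho>" for \<eta>
      using \<rho>(2) subsetD[OF \<rho>(2), of "x + \<eta>"] that by (auto simp: v algebra_simps abs_le_iff)
    have xJ: "x + \<rho> * sin a \<in> ?J" for a
      using J[of "\<rho> * sin a"] \<rho>(1) by (simp add: v algebra_simps abs_mult mult_left_le)
    have cs: "continuous_on UNIV (\<lambda>\<phi>. ?n (x + \<rho> * sin (2 * pi * \<phi>)))"
      by (intro continuous_on_compose2[OF cont] continuous_intros) (use xJ in auto)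
    have "ennreal (?n x) = mean_power H (t + v1 * x) (l + v2 * x)"
      using fin J[of 0] \<rho>(1) by simp
    also have "\<dots> \<le> (\<integral>\<^sup>+\<phi>. mean_power H (t + v1 * (x + \<rho> * sin (2 * pi * \<phi>))) (l + v2 * (x + \<rho> * sin (2 * pi * \<phi>))) \<partial>unit_measure)"
      using mean_power_submean[OF H(1) J \<rho>(1)] by (simp add: v algebra_simps)
    also have "\<dots> = (\<integral>\<^sup>+\<phi>. ennreal (?n (x + \<rho> * sin (2 * pi * \<phi>))) \<partial>unit_measure)"
      using fin xJ by (intro nn_integral_cong) simp
    also have "\<dots> = (\<integral>\<^sup>+\<phi>. ennreal (?n (x + \<rho> * sin (2 * pi * \<phi>))) * indicator {0..1} \<phi> \<partial>lborel)"
      by (intro nn_integral_unit[symmetric] measurable_compose[OF _ measurable_ennreal] borel_measurable_continuous_onI cs)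
    also have "\<dots> = ennreal (integral {0..1} (\<lambda>\<phi>. ?n (x + \<rho> * sin (2 * pi * \<phi>))))"
      by (intro nn_integral_has_integral_lebesgue' integrable_integral integrable_continuous_real continuous_on_subset[OF cs]) auto
    finally show "?n x \<le> integral {0..1} (\<lambda>\<phi>. ?n (x + \<rho> * sin (2 * pi * \<phi>)))"
      by (subst (asm) ennreal_le_iff) (auto intro!: integral_nonneg integrable_continuous_real continuous_on_subset[OF cs])
  qed
qed

section \<open>Uniform continuity of translations in the Hardy norm\<close>

lemma mean_power_less_top: "hardy_bounded H B \<Longrightarrow> (t, l) \<in> rect \<Longrightarrow> mean_power H t l < top"
  using hardy_boundedD by (rule order_le_less_trans) simp_all

lemma mean_power_add_le:
  assumes F: "continuous_on (D' \<beta>) F" and G: "continuous_on (D' \<beta>) G"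
    and r: "(t, l) \<in> rect" and nonneg: "0 \<le> a" "0 \<le> b"
    and le: "\<And>z. cmod (H z) powr p \<le> a * cmod (F z) powr p + b * cmod (G z) powr p"
  shows "mean_power H t l \<le> ennreal a * mean_power F t l + ennreal b * mean_power G t l"
proof -
  note m = borel_measurable_cyl[OF measurable_mean_power[OF F r]] borel_measurable_cyl[OF measurable_mean_power[OF G r]]
  have "mean_power H t l \<le> (\<integral>\<^sup>+\<omega>. ennreal a * ennreal (cmod (F (tube_pt t l \<omega>)) powr p) +
      ennreal b * ennreal (cmod (G (tube_pt t l \<omega>)) powr p) \<partial>cyl_measure)"
    unfolding mean_power_def using le nonneg
    by (intro nn_integral_mono) (simp add: ennreal_mult[symmetric] ennreal_plus[symmetric] del: ennreal_plus)
  also have "\<dots> = ennreal a * mean_power F t l + ennreal b * mean_power G t l"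
    unfolding mean_power_def using m by (simp add: nn_integral_add nn_integral_cmult)
  finally show ?thesis .
qed

lemma mean_power_shift:
  assumes "continuous_on (D' \<beta>) F" "(t, l) \<in> rect"
  shows "mean_power (\<lambda>z. F (flow c d (of_real \<tau>) z)) t l = mean_power F t l"
  using mean_power_flow[of F t c d "of_real \<tau>" l] assms by (simp add: mean_power_def)

lemma continuous_on_shift:
  assumes "continuous_on (D' \<beta>) F"
  shows "continuous_on (D' \<beta>) (\<lambda>z. F (flow c d (of_real \<tau>) z))"
  by (intro continuous_on_compose2[OF assms] continuous_intros) auto

lemma holomorphic2_on_shift:
  assumes "F holomorphic2_on D' \<beta>"
  shows "(\<lambda>z. F (flow c d (of_real \<tau>) z)) holomorphic2_on D' \<beta>"
  using assms by (rule holomorphic2_on_compose_flow) simp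

lemma mean_power_segment:
  assumes H: "H holomorphic2_on D' \<beta>" "hardy_bounded H B"
    and ends: "(t + v1 * a, l + v2 * a) \<in> rect" "(t + v1 * b, l + v2 * b) \<in> rect" and u: "a \<le> u" "u \<le> b"
    and le: "mean_power H (t + v1 * a) (l + v2 * a) \<le> ennreal e" "mean_power H (t + v1 * b) (l + v2 * b) \<le> ennreal e"
    and "0 \<le> e"
  shows "(t + v1 * u, l + v2 * u) \<in> rect" "mean_power H (t + v1 * u) (l + v2 * u) \<le> ennreal e"
proof -
  note cv = mean_power_convex[OF H, of t v1 l v2]
  have "{a..b} \<subseteq> {u. (t + v1 * u, l + v2 * u) \<in> rect}"
    using closed_segment_subset[OF _ _ convex_on_imp_convex[OF cv], of a b] ends u
    by (simp add: closed_segment_eq_real_ivl)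
  then show r: "(t + v1 * u, l + v2 * u) \<in> rect" using u by auto
  have "convex_on {a..b} (\<lambda>u. enn2real (mean_power H (t + v1 * u) (l + v2 * u)))"
    by (rule convex_on_subset[OF cv]) (fact, simp)
  from convex_on_le_max[OF this, of u] u
  have "enn2real (mean_power H (t + v1 * u) (l + v2 * u)) \<le>
     max (enn2real (mean_power H (t + v1 * a) (l + v2 * a))) (enn2real (mean_power H (t + v1 * b) (l + v2 * b)))"
    by simp
  also have "\<dots> \<le> e"
    using enn2real_mono[OF le(1)] enn2real_mono[OF le(2)] \<open>0 \<le> e\<close> by simp
  finally show "mean_power H (t + v1 * u) (l + v2 * u) \<le> ennreal e"
    using mean_power_less_top[OF H(2) r] \<open>0 \<le> e\<close> by (metis ennreal_enn2real ennreal_leI)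
qed

text \<open>
  A function that is convex in each variable attains its maximum over a closed rectangle at a corner.
\<close>

lemma mean_power_corners:
  assumes H: "H holomorphic2_on D' \<beta>" "hardy_bounded H B"
    and u: "0 < u" "u < 1" and tl: "\<bar>t\<bar> \<le> u * (pi / 2)" "\<bar>l\<bar> \<le> u * (\<beta> - pi / 2)" and "0 \<le> e"
    and le: "\<And>a b. a \<in> {-1, 1} \<Longrightarrow> b \<in> {-1, 1} \<Longrightarrow>
      mean_power H (a * (pi / 2) * u) (b * (\<beta> - pi / 2) * u) \<le> ennreal e"
  shows "mean_power H t l \<le> ennreal e"
proof -
  define T S where "T = u * (pi / 2)" and "S = u * (\<beta> - pi / 2)"
  have TS: "0 < T" "T < pi / 2" "0 < S" "S < \<beta> - pi / 2"
    using u \<beta> by (auto simp: T_def S_def)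
  have tl': "- T \<le> t" "t \<le> T" "- S \<le> l" "l \<le> S"
    using tl unfolding T_def S_def by linarith+
  have c: "mean_power H T S \<le> ennreal e" "mean_power H (- T) S \<le> ennreal e"
     "mean_power H T (- S) \<le> ennreal e" "mean_power H (- T) (- S) \<le> ennreal e"
    using le[of 1 1] le[of 1 "-1"] le[of "-1" 1] le[of "-1" "-1"]
    by (simp_all add: T_def S_def algebra_simps)
  have 1: "mean_power H t (S) \<le> ennreal e"
    using mean_power_segment(2)[OF H, of 0 1 "-T" S 0 T t e] c TS tl' \<open>0 \<le> e\<close>
    by (simp add: rect_iff)
  have 2: "mean_power H t (- S) \<le> ennreal e"
    using mean_power_segment(2)[OF H, of 0 1 "-T" "-S" 0 T t e] c TS tl' \<open>0 \<le> e\<close>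
    by (simp add: rect_iff)
  have "\<bar>t\<bar> < pi / 2" using tl(1) TS(2) unfolding T_def by linarith
  then show ?thesis
    using mean_power_segment(2)[OF H, of t 0 "-S" 0 1 S l e] 1 2 TS tl' \<open>0 \<le> e\<close>
    by (simp add: rect_iff)
qed

lemma hardy_bounded_diff_shift:
  assumes F: "F holomorphic2_on D' \<beta>" "hardy_bounded F B" and "0 \<le> B"
  shows "hardy_bounded (\<lambda>z. F z - F (flow c d (of_real \<tau>) z)) (2 * 2 powr p * B)"
  unfolding hardy_bounded_def
proof clarify
  fix t l assume r: "(t, l) \<in> rect"
  have cF: "continuous_on (D' \<beta>) F" using F(1) by (rule holomorphic2_on_imp_continuous_on)
  have "mean_power (\<lambda>z. F z - F (flow c d (of_real \<tau>) z)) t l \<le>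
      ennreal (2 powr p) * mean_power F t l + ennreal (2 powr p) * mean_power (\<lambda>z. F (flow c d (of_real \<tau>) z)) t l"
    using cmod_diff_powr_le[OF p] by (intro mean_power_add_le cF continuous_on_shift r) (auto simp: distrib_left)
  also have "\<dots> \<le> ennreal (2 powr p) * ennreal B + ennreal (2 powr p) * ennreal B"
    unfolding mean_power_shift[OF cF r] using hardy_boundedD[OF F(2) r] by (intro add_mono mult_left_mono) auto
  also have "\<dots> = ennreal (2 * 2 powr p * B)"
    using \<open>0 \<le> B\<close> by (simp add: ennreal_mult[symmetric] ennreal_plus[symmetric] del: ennreal_plus)
  finally show "mean_power (\<lambda>z. F z - F (flow c d (of_real \<tau>) z)) t l \<le> ennreal (2 * 2 powr p * B)" .
qed

text \<open>
  Write \<open>u0\<close> as a convex combination of \<open>0\<close> and \<open>u\<close>: the weight of \<open>0\<close> is at most \<open>1 - u0\<close>, and the value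
  there is at most \<open>B\<close>.
\<close>

lemma mean_power_almost_increasing_on_ray:
  assumes G: "G holomorphic2_on D' \<beta>" "hardy_bounded G B" and "0 \<le> B"
    and ray: "\<And>u. 0 \<le> u \<Longrightarrow> u < 1 \<Longrightarrow> (v1 * u, v2 * u) \<in> rect"
    and u: "0 < u0" "u0 \<le> u" "u < 1"
  shows "enn2real (mean_power G (v1 * u0) (v2 * u0)) \<le> enn2real (mean_power G (v1 * u) (v2 * u)) + (1 - u0) * B"
proof -
  let ?n = "\<lambda>u. enn2real (mean_power G (v1 * u) (v2 * u))"
  have nB: "?n x \<le> B" if "0 \<le> x" "x < 1" for x
    using enn2real_mono[OF hardy_boundedD[OF G(2) ray[OF that]]] \<open>0 \<le> B\<close> by simp
  have cv: "convex_on {u. (v1 * u, v2 * u) \<in> rect} ?n"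
    using mean_power_convex[OF G, of 0 v1 0 v2] by simp
  define s where "s = u0 / u"
  have s: "u0 \<le> s" "s \<le> 1" "0 < s" using u by (auto simp: s_def field_simps)
  have "?n ((1 - s) *\<^sub>R 0 + s *\<^sub>R u) \<le> (1 - s) * ?n 0 + s * ?n u"
    using ray[of 0] ray[of u] s u by (intro convex_onD[OF cv]) auto
  also have "(1 - s) *\<^sub>R 0 + s *\<^sub>R u = u0" using u by (simp add: s_def)
  also have "(1 - s) * ?n 0 + s * ?n u \<le> (1 - u0) * B + 1 * ?n u"
    using s nB[of 0] \<open>0 \<le> B\<close> u by (intro add_mono mult_mono) auto
  finally show ?thesis by simp
qed

text \<open>
  The argument by uniform convexity. \<open>N\<close>, \<open>M n\<close> and \<open>x\<close> are the slice norms of \<open>F\<close>, of the midpoint \<open>G n\<close> of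
  \<open>F\<close> and its translate, and of their difference. Integrating \<open>uniform_convexity_powr\<close> over a slice
  gives \<open>x \<le> 2 \<eta> N + C (N - M n)\<close>, and the defect \<open>N - M n\<close> is controlled by convexity on the whole ray once
  it is small at the single point \<open>u0\<close>.
\<close>

lemma ray_equicontinuous:
  assumes F: "F holomorphic2_on D' \<beta>" "hardy_bounded F B" and "0 \<le> B"
    and ray: "\<And>u. 0 \<le> u \<Longrightarrow> u < 1 \<Longrightarrow> (v1 * u, v2 * u) \<in> rect"
    and \<tau>: "\<tau> \<longlonglongrightarrow> 0" and "0 < \<epsilon>"
  shows "\<exists>u0. 0 < u0 \<and> u0 < 1 \<and> (\<forall>\<^sub>F n in sequentially. \<forall>u. u0 \<le> u \<and> u < 1 \<longrightarrow>
    mean_power (\<lambda>z. F z - F (flow c d (of_real (\<tau> n)) z)) (v1 * u) (v2 * u) \<le> ennreal \<epsilon>)"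
proof -
  define \<eta> where "\<eta> = \<epsilon> / (4 * (B + 1))"
  have \<eta>: "0 < \<eta>" "2 * \<eta> * B \<le> \<epsilon> / 2"
  proof -
    show "0 < \<eta>" using \<open>0 < \<epsilon>\<close> \<open>0 \<le> B\<close> by (simp add: \<eta>_def)
    then have "2 * \<eta> * B \<le> 2 * \<eta> * (B + 1)" by (intro mult_left_mono) auto
    also have "\<dots> = \<epsilon> / 2" using \<open>0 \<le> B\<close> by (simp add: \<eta>_def field_simps)
    finally show "2 * \<eta> * B \<le> \<epsilon> / 2" .
  qed
  obtain C where C: "0 \<le> C" "\<And>a b :: complex. cmod (a - b) powr p + C * cmod ((a + b) / 2) powr p
    \<le> (\<eta> + C / 2) * (cmod a powr p + cmod b powr p)"
    using uniform_convexity_powr[OF p \<eta>(1)] by metis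
  define \<delta> where "\<delta> = min (1 / 2) (\<epsilon> / (2 * (C + 1) * (2 + B)))"
  have \<delta>: "0 < \<delta>" "\<delta> \<le> 1 / 2" "C * ((2 + B) * \<delta>) \<le> \<epsilon> / 2"
  proof -
    show "0 < \<delta>" using \<open>0 < \<epsilon>\<close> \<open>0 \<le> B\<close> C(1) by (auto simp: \<delta>_def)
    show "\<delta> \<le> 1 / 2" unfolding \<delta>_def by (rule min.cobounded1)
    have "\<delta> \<le> \<epsilon> / (2 * (C + 1) * (2 + B))" unfolding \<delta>_def by (rule min.cobounded2)
    have "C * ((2 + B) * \<delta>) \<le> (C + 1) * ((2 + B) * (\<epsilon> / (2 * (C + 1) * (2 + B))))"
      using C(1) \<open>0 \<le> B\<close> \<open>0 < \<delta>\<close> \<open>\<delta> \<le> \<epsilon> / (2 * (C + 1) * (2 + B))\<close> by (intro mult_mono) auto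
    also have "\<dots> = \<epsilon> / 2"
    proof -
      have "x * (y * (\<epsilon> / (2 * x * y))) = \<epsilon> / 2" if "x \<noteq> 0" "y \<noteq> 0" for x y
        using that by (simp add: field_simps)
      moreover have "C + 1 \<noteq> 0" "2 + B \<noteq> 0" using C(1) \<open>0 \<le> B\<close> by auto
      ultimately show ?thesis by blast
    qed
    finally show "C * ((2 + B) * \<delta>) \<le> \<epsilon> / 2" .
  qed
  have cF: "continuous_on (D' \<beta>) F" using F(1) by (rule holomorphic2_on_imp_continuous_on)
  define G where "G n z = (F z + F (flow c d (of_real (\<tau> n)) z)) / 2" for n z
  define N where "N u = enn2real (mean_power F (v1 * u) (v2 * u))" for u
  define M where "M n u = enn2real (mean_power (G n) (v1 * u) (v2 * u))" for n u
  have holG: "G n holomorphic2_on D' \<beta>" for n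
    using holomorphic2_on_cmult[OF holomorphic2_on_add[OF F(1) holomorphic2_on_shift[OF F(1)]], of "1 / 2" c d "\<tau> n"]
    by (simp add: G_def[abs_def])
  have GF: "mean_power (G n) t l \<le> mean_power F t l" if r: "(t, l) \<in> rect" for n t l
  proof -
    have "mean_power (G n) t l \<le> ennreal (1 / 2) * mean_power F t l + ennreal (1 / 2) * mean_power (\<lambda>z. F (flow c d (of_real (\<tau> n)) z)) t l"
      unfolding G_def[abs_def] using cmod_midpoint_powr_le[OF p]
      by (intro mean_power_add_le cF continuous_on_shift r) (auto simp: add_divide_distrib)
    also have "ennreal (1 / 2) * mean_power F t l + ennreal (1 / 2) * mean_power (\<lambda>z. F (flow c d (of_real (\<tau> n)) z)) t l
        = (ennreal (1 / 2) + ennreal (1 / 2)) * mean_power F t l"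
      unfolding mean_power_shift[OF cF r] distrib_right ..
    also have "ennreal (1 / 2) + ennreal (1 / 2) = 1"
      by (subst ennreal_plus[symmetric]) auto
    also have "1 * mean_power F t l = mean_power F t l" by simp
    finally show ?thesis .
  qed
  have bG: "hardy_bounded (G n) B" for n
    unfolding hardy_bounded_def using order_trans[OF GF hardy_boundedD[OF F(2)]] by auto
  have eN: "mean_power F (v1 * u) (v2 * u) = ennreal (N u)" and eM: "mean_power (G n) (v1 * u) (v2 * u) = ennreal (M n u)"
    and NB: "N u \<le> B" and N0: "0 \<le> N u" "0 \<le> M n u"
    if "0 \<le> u" "u < 1" for u n
    using mean_power_less_top[OF F(2) ray[OF that]] mean_power_less_top[OF bG ray[OF that]]
      enn2real_mono[OF hardy_boundedD[OF F(2) ray[OF that]]] \<open>0 \<le> B\<close>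
    by (simp_all add: N_def M_def)
  \<comment> \<open>A point close to 1 beyond which \<open>N\<close> does not exceed its value by more than \<open>\<delta>\<close>.\<close>
  define s where "s = (SUP u\<in>{1 - \<delta>..<1}. N u)"
  have ne: "N ` {1 - \<delta>..<1} \<noteq> {}" and bdd: "bdd_above (N ` {1 - \<delta>..<1})"
    using \<delta> NB by (auto intro!: bdd_aboveI2[where M = B])
  obtain u0 where u0: "1 - \<delta> \<le> u0" "u0 < 1" "s - \<delta> < N u0"
    using less_cSUP_iff[of "{1 - \<delta>..<1}" N "s - \<delta>"] bdd \<delta> by (auto simp: s_def)
  have u0': "0 < u0" "1 - u0 \<le> \<delta>" using u0 \<delta> by auto
  have Nu: "N u \<le> N u0 + \<delta>" if "u0 \<le> u" "u < 1" for u
  proof -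
    have "N u \<le> s" unfolding s_def using that u0 by (intro cSUP_upper bdd) auto
    then show ?thesis using u0 by simp
  qed
  \<comment> \<open>Fatou on the slice over the fixed interior point \<open>u0\<close>.\<close>
  have ev: "\<forall>\<^sub>F n in sequentially. N u0 - \<delta> < M n u0"
  proof -
    have r0: "(v1 * u0, v2 * u0) \<in> rect" using ray[of u0] u0 u0' by simp
    let ?f = "\<lambda>n \<omega>. ennreal (cmod (G n (tube_pt (v1 * u0) (v2 * u0) \<omega>)) powr p)"
    have lim: "(\<lambda>n. ?f n \<omega>) \<longlonglongrightarrow> ennreal (cmod (F (tube_pt (v1 * u0) (v2 * u0) \<omega>)) powr p)" for \<omega>
    proof -
      let ?z = "tube_pt (v1 * u0) (v2 * u0) \<omega>"
      have "isCont (\<lambda>x. flow c d (of_real x) ?z) 0"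
        using continuous_on_eq_continuous_at[OF open_UNIV, of "\<lambda>x::real. flow c d (of_real x) ?z"]
        by (auto intro!: continuous_intros)
      from isCont_tendsto_compose[OF this \<tau>]
      have 1: "(\<lambda>n. flow c d (of_real (\<tau> n)) ?z) \<longlonglongrightarrow> ?z" by simp
      have "isCont F ?z"
        using cF open_D' r0 by (simp add: continuous_on_eq_continuous_at)
      from isCont_tendsto_compose[OF this 1]
      have "(\<lambda>n. G n ?z) \<longlonglongrightarrow> (F ?z + F ?z) / 2"
        unfolding G_def by (intro tendsto_intros) auto
      then show ?thesis using p
        by (intro tendsto_ennrealI tendsto_powr' tendsto_norm) auto
    qed
    have "mean_power F (v1 * u0) (v2 * u0) = (\<integral>\<^sup>+\<omega>. liminf (\<lambda>n. ?f n \<omega>) \<partial>cyl_measure)"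
      unfolding mean_power_def using lim_imp_Liminf[OF _ lim] by simp
    also have "\<dots> \<le> liminf (\<lambda>n. mean_power (G n) (v1 * u0) (v2 * u0))"
      unfolding mean_power_def
      by (intro nn_integral_liminf borel_measurable_cyl measurable_mean_power r0
          holomorphic2_on_imp_continuous_on[OF holG])
    finally have liminf: "ennreal (N u0) \<le> liminf (\<lambda>n. ennreal (M n u0))"
      using u0 u0' by (simp add: eN eM)
    show ?thesis
    proof (cases "N u0 - \<delta> < 0")
      case True
      then have "N u0 - \<delta> < M n u0" for n
        using N0(2)[of u0 n] u0 u0' by simp
      then show ?thesis by simp
    next
      case False
      then have "ennreal (N u0 - \<delta>) < ennreal (N u0)"
        using \<delta> by (intro ennreal_lessI) auto
      then have "ennreal (N u0 - \<delta>) < liminf (\<lambda>n. ennreal (M n u0))"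
        using liminf by (rule less_le_trans)
      then have "\<forall>\<^sub>F n in sequentially. ennreal (N u0 - \<delta>) < ennreal (M n u0)"
        by (rule less_LiminfD)
      then show ?thesis
        by eventually_elim (use False in \<open>simp add: ennreal_less_iff\<close>)
    qed
  qed
  have "\<forall>\<^sub>F n in sequentially. \<forall>u. u0 \<le> u \<and> u < 1 \<longrightarrow>
    mean_power (\<lambda>z. F z - F (flow c d (of_real (\<tau> n)) z)) (v1 * u) (v2 * u) \<le> ennreal \<epsilon>"
    using ev
  proof eventually_elim
    case (elim n)
    show ?case
    proof clarify
      fix u assume u: "u0 \<le> u" "u < 1"
      then have u': "0 \<le> u" using u0' by simp
      note r = ray[OF u' u(2)]
      let ?Fs = "\<lambda>z. F (flow c d (of_real (\<tau> n)) z)"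
      let ?D = "\<lambda>z. F z - ?Fs z"
      have cD: "continuous_on (D' \<beta>) ?D" by (intro continuous_intros cF continuous_on_shift)
      have "mean_power ?D (v1 * u) (v2 * u) + ennreal C * mean_power (G n) (v1 * u) (v2 * u) =
        (\<integral>\<^sup>+\<omega>. ennreal (cmod (?D (tube_pt (v1 * u) (v2 * u) \<omega>)) powr p) + ennreal C * ennreal (cmod (G n (tube_pt (v1 * u) (v2 * u) \<omega>)) powr p) \<partial>cyl_measure)"
        unfolding mean_power_def
        using borel_measurable_cyl[OF measurable_mean_power[OF cD r]]
          borel_measurable_cyl[OF measurable_mean_power[OF holomorphic2_on_imp_continuous_on[OF holG] r]]
        by (simp add: nn_integral_add nn_integral_cmult)
      also have "\<dots> \<le> (\<integral>\<^sup>+\<omega>. ennreal (\<eta> + C / 2) * ennreal (cmod (F (tube_pt (v1 * u) (v2 * u) \<omega>)) powr p) +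
          ennreal (\<eta> + C / 2) * ennreal (cmod (?Fs (tube_pt (v1 * u) (v2 * u) \<omega>)) powr p) \<partial>cyl_measure)"
        using C \<eta>(1) by (intro nn_integral_mono)
          (simp add: G_def ennreal_mult[symmetric] ennreal_plus[symmetric] distrib_left[symmetric] del: ennreal_plus)
      also have "\<dots> = ennreal (\<eta> + C / 2) * mean_power F (v1 * u) (v2 * u) + ennreal (\<eta> + C / 2) * mean_power ?Fs (v1 * u) (v2 * u)"
        unfolding mean_power_def
        using borel_measurable_cyl[OF measurable_mean_power[OF cF r]]
          borel_measurable_cyl[OF measurable_mean_power[OF continuous_on_shift[OF cF] r]]
        by (simp add: nn_integral_add nn_integral_cmult)
      also have "\<dots> = ennreal ((2 * \<eta> + C) * N u)"
        unfolding mean_power_shift[OF cF r] eN[OF u' u(2)]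
        using C(1) \<eta>(1) N0(1)[OF u' u(2)]
        by (simp add: ennreal_mult[symmetric] ennreal_plus[symmetric] distrib_right[symmetric] del: ennreal_plus)
      finally have main: "mean_power ?D (v1 * u) (v2 * u) + ennreal C * ennreal (M n u) \<le> ennreal ((2 * \<eta> + C) * N u)"
        unfolding eM[OF u' u(2)] .
      have fin: "mean_power ?D (v1 * u) (v2 * u) < top"
        using mean_power_less_top[OF hardy_bounded_diff_shift[OF F \<open>0 \<le> B\<close>] r] .
      define x where "x = enn2real (mean_power ?D (v1 * u) (v2 * u))"
      have ex: "mean_power ?D (v1 * u) (v2 * u) = ennreal x" and x0: "0 \<le> x"
        using fin by (auto simp: x_def)
      have "x + C * M n u \<le> (2 * \<eta> + C) * N u"
        using main C(1) \<eta>(1) x0 N0(1)[OF u' u(2)] N0(2)[OF u' u(2), of n] unfolding ex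
        by (simp add: ennreal_mult[symmetric] ennreal_plus[symmetric] del: ennreal_plus)
      \<comment> \<open>Three losses: \<open>\<delta>\<close> from the choice of \<open>u0\<close>, \<open>\<delta>\<close> from Fatou, and \<open>B * \<delta>\<close> from convexity.\<close>
      moreover have "N u - M n u \<le> (2 + B) * \<delta>"
      proof -
        have "M n u0 \<le> M n u + (1 - u0) * B"
          unfolding M_def using mean_power_almost_increasing_on_ray[OF holG bG \<open>0 \<le> B\<close> ray u0'(1) u] .
        moreover have "(1 - u0) * B \<le> \<delta> * B" using u0' \<open>0 \<le> B\<close> by (intro mult_right_mono) auto
        ultimately show ?thesis using Nu[OF u] elim by (simp add: algebra_simps)
      qed
      then have "C * (N u - M n u) \<le> C * ((2 + B) * \<delta>)"
        using C(1) by (intro mult_left_mono) auto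
      moreover have "2 * \<eta> * N u \<le> 2 * \<eta> * B"
        using NB[OF u' u(2)] \<eta>(1) by (intro mult_left_mono) auto
      ultimately have "x \<le> \<epsilon>" using \<eta>(2) \<delta>(3) by (simp add: algebra_simps)
      then show "mean_power ?D (v1 * u) (v2 * u) \<le> ennreal \<epsilon>" unfolding ex by (rule ennreal_leI)
    qed
  qed
  with u0 u0' show ?thesis by blast
qed

text \<open>
  The estimate on the four diagonals spreads to the whole rectangle, because a given point lies in a
  smaller rectangle with corners on the diagonals, as close to the corners of the full rectangle as needed.
\<close>

lemma shift_equicontinuous:
  assumes F: "F holomorphic2_on D' \<beta>" "hardy_bounded F B" and "0 \<le> B" and "0 < \<epsilon>"
  shows "\<exists>\<delta>>0. \<forall>\<tau>. \<bar>\<tau>\<bar> < \<delta> \<longrightarrow> hardy_bounded (\<lambda>z. F z - F (flow c d (of_real \<tau>) z)) \<epsilon>"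
proof (rule ccontr)
  assume "\<not> ?thesis"
  then have "\<exists>\<tau>. \<bar>\<tau>\<bar> < inverse (real (Suc n)) \<and> \<not> hardy_bounded (\<lambda>z. F z - F (flow c d (of_real \<tau>) z)) \<epsilon>" for n
    by (metis inverse_positive_iff_positive of_nat_0_less_iff zero_less_Suc)
  then obtain \<tau> where \<tau>: "\<And>n. \<bar>\<tau> n\<bar> < inverse (real (Suc n))"
      "\<And>n. \<not> hardy_bounded (\<lambda>z. F z - F (flow c d (of_real (\<tau> n)) z)) \<epsilon>"
    by metis
  have "\<tau> \<longlonglongrightarrow> 0"
    using \<tau>(1) by (intro tendsto_rabs_zero_cancel[OF tendsto_sandwich[OF _ _ tendsto_const LIMSEQ_inverse_real_of_nat]])
      (auto intro!: always_eventually less_imp_le)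
  have ray: "(a * (pi / 2) * u, b * (\<beta> - pi / 2) * u) \<in> rect"
    if "0 \<le> u" "u < 1" "a \<in> {-1, 1}" "b \<in> {-1, 1}" for u a b :: real
    using that \<beta> mult_strict_left_mono[of u 1 "pi / 2"] mult_strict_left_mono[of u 1 "\<beta> - pi / 2"]
    by (auto simp: rect_iff abs_mult)
  let ?D = "\<lambda>n z. F z - F (flow c d (of_real (\<tau> n)) z)"
  define P where "P a b u0 \<longleftrightarrow> (\<forall>\<^sub>F n in sequentially. \<forall>u. u0 \<le> u \<and> u < 1 \<longrightarrow>
    mean_power (?D n) (a * (pi / 2) * u) (b * (\<beta> - pi / 2) * u) \<le> ennreal \<epsilon>)" for a b u0
  have "\<exists>u0. 0 < u0 \<and> u0 < 1 \<and> P a b u0" if "a \<in> {-1, 1}" "b \<in> {-1, 1}" for a b :: real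
    unfolding P_def using that by (intro ray_equicontinuous[OF F \<open>0 \<le> B\<close> _ \<open>\<tau> \<longlonglongrightarrow> 0\<close> \<open>0 < \<epsilon>\<close>] ray)
  then obtain u0 where u0: "\<And>a b. a \<in> {-1, 1} \<Longrightarrow> b \<in> {-1, 1} \<Longrightarrow> 0 < u0 a b \<and> u0 a b < (1::real) \<and> P a b (u0 a b)"
    by metis
  have "\<forall>\<^sub>F n in sequentially. \<forall>a\<in>{-1, 1}. \<forall>b\<in>{-1, 1}. \<forall>u. u0 a b \<le> u \<and> u < 1 \<longrightarrow>
    mean_power (?D n) (a * (pi / 2) * u) (b * (\<beta> - pi / 2) * u) \<le> ennreal \<epsilon>"
    using u0 unfolding P_def by (intro eventually_ball_finite ballI) auto
  from eventually_happens'[OF sequentially_bot this]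
  obtain n where n0: "\<forall>a\<in>{-1, 1}. \<forall>b\<in>{-1, 1}. \<forall>u. u0 a b \<le> u \<and> u < 1 \<longrightarrow>
    mean_power (?D n) (a * (pi / 2) * u) (b * (\<beta> - pi / 2) * u) \<le> ennreal \<epsilon>"
    by (rule exE)
  note n = n0[rule_format]
  have "hardy_bounded (?D n) \<epsilon>"
    unfolding hardy_bounded_def
  proof clarify
    fix t l assume r: "(t, l) \<in> rect"
    have "finite {u0 1 1, u0 1 (-1), u0 (-1) 1, u0 (-1) (-1), \<bar>t\<bar> / (pi / 2), \<bar>l\<bar> / (\<beta> - pi / 2)}" (is "finite ?U")
      by simp
    define u where "u = Max ?U"
    have u: "x \<le> u" if "x \<in> ?U" for x
      unfolding u_def using that by (intro Max_ge) auto
    have "u \<in> ?U" unfolding u_def by (intro Max_in) auto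
    moreover have "x < 1" if "x \<in> ?U" for x
      using that r u0 \<beta> by (auto simp: rect_iff)
    ultimately have "u < 1" by blast
    have "0 < u" using u[of "u0 1 1"] u0[of 1 1] by auto
    have tl: "\<bar>t\<bar> \<le> u * (pi / 2)" "\<bar>l\<bar> \<le> u * (\<beta> - pi / 2)"
      using u[of "\<bar>t\<bar> / (pi / 2)"] u[of "\<bar>l\<bar> / (\<beta> - pi / 2)"] \<beta> by (auto simp: divide_le_eq)
    have hD: "?D n holomorphic2_on D' \<beta>"
      by (intro holomorphic2_on_diff F(1) holomorphic2_on_shift)
    show "mean_power (?D n) t l \<le> ennreal \<epsilon>"
    proof (rule mean_power_corners[OF hD hardy_bounded_diff_shift[OF F \<open>0 \<le> B\<close>] \<open>0 < u\<close> \<open>u < 1\<close> tl])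
      fix a b :: real assume ab: "a \<in> {-1, 1}" "b \<in> {-1, 1}"
      have "u0 a b \<le> u" using ab by (intro u) auto
      then show "mean_power (?D n) (a * (pi / 2) * u) (b * (\<beta> - pi / 2) * u) \<le> ennreal \<epsilon>"
        using n[OF ab] \<open>u < 1\<close> by blast
    qed (use \<open>0 < \<epsilon>\<close> in simp)
  qed
  with \<tau>(2) show False by blast
qed

section \<open>Approximation by averages\<close>

text \<open>
  Jensen's inequality on the average, followed by Tonelli.
\<close>

lemma hardy_bounded_average:
  assumes K: "continuous_on (UNIV \<times> D' \<beta>) (\<lambda>x. K (fst x) (snd x))"
    and b: "\<And>\<tau>::real. \<tau> \<in> {0..1} \<Longrightarrow> hardy_bounded (K \<tau>) B"
  shows "hardy_bounded (\<lambda>z. integral {0..1} (\<lambda>\<tau>. K \<tau> z)) B"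
  unfolding hardy_bounded_def
proof clarify
  fix t l assume r: "(t, l) \<in> rect"
  have "continuous_on UNIV (\<lambda>x. K (snd x) (tube_pt t l (fst x)))"
    using r by (intro continuous_on_compose2[OF K, where f = "\<lambda>x. (snd x, tube_pt t l (fst x))", simplified] continuous_intros) auto
  then have "(\<lambda>x. ennreal (cmod (K (snd x) (tube_pt t l (fst x))) powr p)) \<in> borel_measurable borel"
    using p by (intro measurable_compose[OF _ measurable_ennreal] borel_measurable_continuous_onI
        continuous_on_powr' continuous_intros) auto
  then have m: "(\<lambda>x. ennreal (cmod (K (snd x) (tube_pt t l (fst x))) powr p)) \<in> borel_measurable (cyl_measure \<Otimes>\<^sub>M unit_measure)"
    using measurable_cong_sets[OF sets_cyl_unit refl] by blast
  have "mean_power (\<lambda>z. integral {0..1} (\<lambda>\<tau>. K \<tau> z)) t l \<le>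
     (\<integral>\<^sup>+\<omega>. (\<integral>\<^sup>+\<tau>. ennreal (cmod (K \<tau> (tube_pt t l \<omega>)) powr p) \<partial>unit_measure) \<partial>cyl_measure)"
    unfolding mean_power_def
  proof (intro nn_integral_mono jensen_integral p)
    fix \<omega>
    show "continuous_on {0..1} (\<lambda>\<tau>. K \<tau> (tube_pt t l \<omega>))"
      using r by (intro continuous_on_compose2[OF K, where f = "\<lambda>\<tau>. (\<tau>, tube_pt t l \<omega>)", simplified] continuous_intros) auto
  qed
  also have "\<dots> = (\<integral>\<^sup>+\<tau>. mean_power (K \<tau>) t l \<partial>unit_measure)"
    using cyl_unit.Fubini[OF m] by (simp add: mean_power_def)
  also have "\<dots> \<le> (\<integral>\<^sup>+\<tau>. ennreal B \<partial>unit_measure)"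
    by (intro nn_integral_mono_AE eventually_mono[OF AE_unit] hardy_boundedD[OF b r])
  also have "\<dots> = ennreal B" by (rule nn_integral_const_unit)
  finally show "mean_power (\<lambda>z. integral {0..1} (\<lambda>\<tau>. K \<tau> z)) t l \<le> ennreal B" .
qed

lemma continuous_on_flow_comp:
  assumes "continuous_on (D' \<beta>) F"
  shows "continuous_on (UNIV \<times> D' \<beta>) (\<lambda>x. F (flow c d (of_real (h * fst x)) (snd x)))"
  by (intro continuous_on_compose2[OF assms] continuous_intros) (auto simp del: of_real_mult)

lemma hardy_bounded_avg:
  assumes F: "continuous_on (D' \<beta>) F" "hardy_bounded F B"
  shows "hardy_bounded (avg c d h F) B"
  unfolding avg_def
proof (rule hardy_bounded_average)
  show "hardy_bounded (\<lambda>z. F (flow c d (of_real (h * \<tau>)) z)) B" for \<tau>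
    unfolding hardy_bounded_def using hardy_boundedD[OF F(2)] mean_power_shift[OF F(1)] by (auto simp del: of_real_mult)
qed (rule continuous_on_flow_comp[OF F(1)])

lemma avg_approximates:
  assumes F: "F holomorphic2_on D' \<beta>" "hardy_bounded F B" and "0 \<le> B" and "0 < \<epsilon>"
  shows "\<exists>h>0. h \<le> 1 \<and> hardy_bounded (\<lambda>z. F z - avg c d h F z) \<epsilon>"
proof -
  obtain \<delta> where \<delta>: "0 < \<delta>" "\<And>\<tau>. \<bar>\<tau>\<bar> < \<delta> \<Longrightarrow> hardy_bounded (\<lambda>z. F z - F (flow c d (of_real \<tau>) z)) \<epsilon>"
    using shift_equicontinuous[OF assms] by blast
  define h where "h = min 1 (\<delta> / 2)"
  have h: "0 < h" "h \<le> 1" "h < \<delta>" using \<delta>(1) by (auto simp: h_def)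
  have cF: "continuous_on (D' \<beta>) F" using F(1) by (rule holomorphic2_on_imp_continuous_on)
  have "hardy_bounded (\<lambda>z. integral {0..1} (\<lambda>\<tau>. F z - F (flow c d (of_real (h * \<tau>)) z))) \<epsilon>"
  proof (rule hardy_bounded_average)
    show "continuous_on (UNIV \<times> D' \<beta>) (\<lambda>x. F (snd x) - F (flow c d (of_real (h * fst x)) (snd x)))"
      by (intro continuous_on_diff continuous_on_flow_comp cF continuous_on_compose2[OF cF] continuous_intros) auto
    fix \<tau> :: real assume "\<tau> \<in> {0..1}"
    then have "\<bar>h * \<tau>\<bar> \<le> h" using h by (simp add: abs_mult mult_left_le)
    then show "hardy_bounded (\<lambda>z. F z - F (flow c d (of_real (h * \<tau>)) z)) \<epsilon>"
      using h by (intro \<delta>) auto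
  qed
  moreover have "mean_power (\<lambda>z. F z - avg c d h F z) t l =
      mean_power (\<lambda>z. integral {0..1} (\<lambda>\<tau>. F z - F (flow c d (of_real (h * \<tau>)) z))) t l" if r: "(t, l) \<in> rect" for t l
    unfolding mean_power_def
  proof (intro nn_integral_cong)
    fix \<omega>
    have "(\<lambda>\<tau>. F (flow c d (of_real (h * \<tau>)) (tube_pt t l \<omega>))) integrable_on {0..1}"
      using r by (intro integrable_continuous_real continuous_on_compose2[OF cF] continuous_intros) (auto simp del: of_real_mult)
    from has_integral_diff[OF has_integral_const_real[of "F (tube_pt t l \<omega>)" 0 1] integrable_integral[OF this]]
    have "integral {0..1} (\<lambda>\<tau>. F (tube_pt t l \<omega>) - F (flow c d (of_real (h * \<tau>)) (tube_pt t l \<omega>))) =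
       F (tube_pt t l \<omega>) - avg c d h F (tube_pt t l \<omega>)"
      by (simp add: avg_def integral_unique)
    then show "ennreal (cmod (F (tube_pt t l \<omega>) - avg c d h F (tube_pt t l \<omega>)) powr p) =
      ennreal (cmod (integral {0..1} (\<lambda>\<tau>. F (tube_pt t l \<omega>) - F (flow c d (of_real (h * \<tau>)) (tube_pt t l \<omega>)))) powr p)"
      by simp
  qed
  ultimately have "hardy_bounded (\<lambda>z. F z - avg c d h F z) \<epsilon>"
    unfolding hardy_bounded_def by auto
  with h show ?thesis by blast
qed

section \<open>Continuity of iterated averages up to the boundary\<close>

lemma flow_segment_in_D':
  assumes z: "z \<in> D' \<beta>" "flow c d \<zeta> z \<in> D' \<beta>" and s: "0 \<le> s" "s \<le> 1"
  shows "flow c d (of_real s * \<zeta>) z \<in> D' \<beta>"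
proof -
  obtain t l \<omega> where tl: "z = tube_pt t l \<omega>" "(t, l) \<in> rect" using z(1) by (rule D'_cases)
  have 1: "(t + (c - 2 * d) * Im \<zeta>, l + 2 * d * Im \<zeta>) \<in> rect"
    using z(2) unfolding tl(1) flow_tube_pt by simp
  have "(1 - s) *\<^sub>R (t, l) + s *\<^sub>R (t + (c - 2 * d) * Im \<zeta>, l + 2 * d * Im \<zeta>) \<in> rect"
    using s by (intro convexD[OF convex_rect tl(2) 1]) auto
  moreover have "(1 - s) *\<^sub>R (t, l) + s *\<^sub>R (t + (c - 2 * d) * Im \<zeta>, l + 2 * d * Im \<zeta>) =
      (t + (c - 2 * d) * Im (of_real s * \<zeta>), l + 2 * d * Im (of_real s * \<zeta>))"
    by (simp add: algebra_simps)
  ultimately show ?thesis unfolding tl(1) flow_tube_pt by simp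
qed

lemma avg_bounded:
  assumes G: "continuous_on (D' \<beta>) G" and M: "\<And>z. z \<in> D' \<beta> \<Longrightarrow> cmod (G z) \<le> M" and z: "z \<in> D' \<beta>"
  shows "cmod (avg c d h G z) \<le> M"
proof -
  have inD: "flow c d (of_real (h * \<tau>)) z \<in> D' \<beta>" for \<tau> using z by (simp del: of_real_mult)
  have "cmod (avg c d h G z) \<le> integral {0..1} (\<lambda>\<tau>::real. M)"
    unfolding avg_def
    by (intro integral_norm_bound_integral integrable_continuous_real continuous_on_compose2[OF G] continuous_intros M inD)
      (use inD in \<open>auto simp del: of_real_mult\<close>)
  then show ?thesis by simp
qed

text \<open>
  The average of a bounded function gains a bounded derivative along the flow that it was taken along.
\<close>

lemma avg_lipschitz_own_flow:
  assumes G: "G holomorphic2_on D' \<beta>" and M: "\<And>z. z \<in> D' \<beta> \<Longrightarrow> cmod (G z) \<le> M" and h: "0 < h"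
    and z: "z \<in> D' \<beta>" "flow c d \<zeta> z \<in> D' \<beta>"
  shows "cmod (avg c d h G (flow c d \<zeta> z) - avg c d h G z) \<le> 2 * M / h * cmod \<zeta>"
proof -
  define W where "W = (\<lambda>\<zeta>. flow c d \<zeta> z) -` D' \<beta>"
  have "open W"
    unfolding W_def by (intro open_vimage open_D' continuous_intros)
  have W: "\<xi> + of_real s \<in> W" if "\<xi> \<in> W" for \<xi> s
    using that flow_flow[of c d "of_real s" \<xi> z] by (simp add: W_def add.commute)
      (metis flow_real_in_D')
  have hol: "(\<lambda>\<zeta>. G (flow c d \<zeta> z)) holomorphic_on W"
    unfolding holomorphic_on_def W_def
    by (intro ballI field_differentiable_at_within[OF field_differentiable_along_flow[OF G]]) (erule vimageD)
  have eq: "avg c d h G (flow c d \<xi> z) = integral {0..1} (\<lambda>\<tau>. G (flow c d (\<xi> + of_real (h * \<tau>)) z))" for \<xi>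
    unfolding avg_def flow_flow by (simp only: add.commute)
  have der: "((\<lambda>\<xi>. avg c d h G (flow c d \<xi> z)) has_field_derivative
      (G (flow c d (\<xi> + of_real h) z) - G (flow c d \<xi> z)) / of_real h) (at \<xi>)" if "\<xi> \<in> W" for \<xi>
    unfolding eq using average_along_line_has_derivative[OF hol \<open>open W\<close> W _ that] h by simp
  have seg: "closed_segment 0 \<zeta> \<subseteq> W"
    using flow_segment_in_D'[OF z] by (auto simp: closed_segment_def W_def scaleR_conv_of_real)
  have "cmod ((avg c d h G (flow c d \<zeta> z)) - (avg c d h G (flow c d 0 z))) \<le> 2 * M / h * cmod (\<zeta> - 0)"
  proof (rule field_differentiable_bound[where S = "closed_segment 0 \<zeta>"])
    fix \<xi> assume "\<xi> \<in> closed_segment 0 \<zeta>"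
    then have \<xi>: "\<xi> \<in> W" using seg by auto
    show "((\<lambda>\<xi>. avg c d h G (flow c d \<xi> z)) has_field_derivative
      (G (flow c d (\<xi> + of_real h) z) - G (flow c d \<xi> z)) / of_real h) (at \<xi> within closed_segment 0 \<zeta>)"
      by (rule has_field_derivative_at_within[OF der[OF \<xi>]])
    have "cmod (G (flow c d (\<xi> + of_real h) z) - G (flow c d \<xi> z)) \<le> M + M"
      using W[OF \<xi>, of h] \<xi> by (intro norm_triangle_le_diff add_mono M) (auto simp: W_def)
    then show "cmod ((G (flow c d (\<xi> + of_real h) z) - G (flow c d \<xi> z)) / of_real h) \<le> 2 * M / h"
      using h by (simp add: norm_divide divide_right_mono)
  qed auto
  then show ?thesis by simp
qed

text \<open>
  All flows commute, so an average keeps a Lipschitz bound along any other flow.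
\<close>

lemma avg_lipschitz_other_flow:
  assumes G: "continuous_on (D' \<beta>) G"
    and L: "\<And>z. z \<in> D' \<beta> \<Longrightarrow> flow c' d' \<zeta> z \<in> D' \<beta> \<Longrightarrow> cmod (G (flow c' d' \<zeta> z) - G z) \<le> L"
    and z: "z \<in> D' \<beta>" "flow c' d' \<zeta> z \<in> D' \<beta>"
  shows "cmod (avg c d h G (flow c' d' \<zeta> z) - avg c d h G z) \<le> L"
proof -
  have comm: "flow c d \<xi> (flow c' d' \<zeta> z) = flow c' d' \<zeta> (flow c d \<xi> z)" for \<xi>
    by (simp add: flow_def)
  have inD: "flow c d (of_real (h * \<tau>)) z \<in> D' \<beta>" "flow c d (of_real (h * \<tau>)) (flow c' d' \<zeta> z) \<in> D' \<beta>" for \<tau>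
    using z by (simp_all del: of_real_mult)
  have i: "(\<lambda>\<tau>. G (flow c d (of_real (h * \<tau>)) z)) integrable_on {0..1}"
     "(\<lambda>\<tau>. G (flow c d (of_real (h * \<tau>)) (flow c' d' \<zeta> z))) integrable_on {0..1}"
    using inD by (auto intro!: integrable_continuous_real continuous_on_compose2[OF G] continuous_intros simp del: of_real_mult)
  have "avg c d h G (flow c' d' \<zeta> z) - avg c d h G z = integral {0..1} (\<lambda>\<tau>.
      G (flow c d (of_real (h * \<tau>)) (flow c' d' \<zeta> z)) - G (flow c d (of_real (h * \<tau>)) z))"
    unfolding avg_def by (rule integral_diff[symmetric]) (rule i)+
  also have "cmod \<dots> \<le> integral {0..1} (\<lambda>\<tau>::real. L)"
  proof (rule integral_norm_bound_integral)
    show "(\<lambda>\<tau>. G (flow c d (of_real (h * \<tau>)) (flow c' d' \<zeta> z)) - G (flow c d (of_real (h * \<tau>)) z)) integrable_on {0..1}"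
      by (intro integrable_diff i)
    show "cmod (G (flow c d (of_real (h * \<tau>)) (flow c' d' \<zeta> z)) - G (flow c d (of_real (h * \<tau>)) z)) \<le> L" for \<tau>
      unfolding comm using inD[of \<tau>] unfolding comm by (intro L)
  qed auto
  finally show ?thesis by simp
qed

text \<open>
  Along \<open>flow 1 0\<close> only \<open>x\<close> moves, and the first average is dominated by the integral over all \<open>x\<close>. The other flow
  makes \<open>\<theta>\<close> run through an interval of length \<open>k \<le> 1\<close>, which is dominated by the integral over a full
  period. The resulting integral over the whole slice is bounded independently of the slice. The coefficients
  \<open>- 4 * pi\<close> and \<open>- 2 * pi\<close> are chosen so that \<open>\<theta>\<close> moves with speed 1 and so that, for complex times,
  \<open>t\<close> stays fixed.
\<close>

lemma double_avg_bounded: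
  assumes F: "continuous_on (D' \<beta>) F" "hardy_bounded F B" and "0 \<le> B"
    and h: "0 < h" and k: "0 < k" "k \<le> 1" and cA: "continuous_on (D' \<beta>) (avg 1 0 h F)"
  shows "\<exists>M. \<forall>z\<in>D' \<beta>. cmod (avg (- 4 * pi) (- 2 * pi) k (avg 1 0 h F) z) \<le> M"
proof -
  have "cmod (avg (- 4 * pi) (- 2 * pi) k (avg 1 0 h F) z) powr p \<le> B / (h * k)" if "z \<in> D' \<beta>" for z
  proof -
    obtain t l \<omega> where z: "z = tube_pt t l \<omega>" and r: "(t, l) \<in> rect"
      using \<open>z \<in> D' \<beta>\<close> by (rule D'_cases)
    let ?f = "\<lambda>\<omega>. ennreal (cmod (F (tube_pt t l \<omega>)) powr p)"
    have fm: "?f \<in> borel_measurable borel" by (rule measurable_mean_power[OF F(1) r])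
    have fm': "(\<lambda>x. ?f (x, \<theta>)) \<in> borel_measurable borel" for \<theta>
      using r by (intro borel_measurable_power_comp F(1) continuous_intros) auto
    define m where "m \<theta> = (\<integral>\<^sup>+x. ?f (x, \<theta>) \<partial>lborel)" for \<theta>
    have mm: "m \<in> borel_measurable borel"
    proof -
      have "(\<lambda>y. ?f (snd y, fst y)) \<in> borel_measurable borel"
        using r by (intro borel_measurable_power_comp F(1) continuous_intros) auto
      moreover have "sets (borel \<Otimes>\<^sub>M (lborel :: real measure)) = sets (borel :: (real \<times> real) measure)"
        unfolding borel_prod[symmetric] by (intro sets_pair_measure_cong) auto
      ultimately have "(\<lambda>y. ?f (snd y, fst y)) \<in> borel_measurable (borel \<Otimes>\<^sub>M lborel)"
        using measurable_cong_sets by blast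
      from lborel.borel_measurable_nn_integral_fst[OF this] show ?thesis
        by (simp add: m_def[abs_def])
    qed
    have per: "m (\<theta> + 1) = m \<theta>" for \<theta> by (simp add: m_def)
    have im: "(\<integral>\<^sup>+\<theta>. m \<theta> \<partial>unit_measure) = mean_power F t l"
      unfolding m_def mean_power_def by (rule cyl.nn_integral_snd) (rule borel_measurable_cyl[OF fm])
    have inner: "ennreal (cmod (avg 1 0 h F (tube_pt t l (x, \<theta>))) powr p) \<le> ennreal (1 / h) * m \<theta>" for x \<theta>
    proof -
      have fl: "flow 1 0 (of_real (h * \<tau>)) (tube_pt t l (x, \<theta>)) = tube_pt t l (x + h * \<tau>, \<theta>)" for \<tau>
        unfolding flow_tube_pt by simp
      have "ennreal (cmod (avg 1 0 h F (tube_pt t l (x, \<theta>))) powr p) \<le> (\<integral>\<^sup>+\<tau>. ?f (x + h * \<tau>, \<theta>) \<partial>unit_measure)"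
        unfolding avg_def fl using r
        by (intro jensen_integral p continuous_on_compose2[OF F(1)] continuous_intros) auto
      also have "\<dots> = ennreal (1 / h) * (\<integral>\<^sup>+x'. ?f (x', \<theta>) * indicator {x..x + h} x' \<partial>lborel)"
        by (rule nn_integral_unit_scale[OF fm' h])
      also have "\<dots> \<le> ennreal (1 / h) * m \<theta>"
        unfolding m_def by (intro mult_left_mono nn_integral_mono) (auto simp: indicator_def)
      finally show ?thesis .
    qed
    obtain x0 \<theta>0 where \<omega>: "\<omega> = (x0, \<theta>0)" by (cases \<omega>)
    have fl: "flow (- 4 * pi) (- 2 * pi) (of_real (k * \<tau>)) z = tube_pt t l (x0 + - 4 * pi * (k * \<tau>), \<theta>0 + k * \<tau>)" for \<tau>
      unfolding z \<omega> flow_tube_pt by simp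
    have "ennreal (cmod (avg (- 4 * pi) (- 2 * pi) k (avg 1 0 h F) z) powr p) \<le>
      (\<integral>\<^sup>+\<tau>. ennreal (cmod (avg 1 0 h F (tube_pt t l (x0 + - 4 * pi * (k * \<tau>), \<theta>0 + k * \<tau>))) powr p) \<partial>unit_measure)"
      unfolding avg_def[of "- 4 * pi"] fl using r
      by (intro jensen_integral p continuous_on_compose2[OF cA] continuous_intros) auto
    also have "\<dots> \<le> (\<integral>\<^sup>+\<tau>. ennreal (1 / h) * m (\<theta>0 + k * \<tau>) \<partial>unit_measure)"
      by (intro nn_integral_mono inner)
    also have "\<dots> = ennreal (1 / h) * (\<integral>\<^sup>+\<tau>. m (\<theta>0 + k * \<tau>) \<partial>unit_measure)"
      using mm by (intro nn_integral_cmult) simp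
    also have "(\<integral>\<^sup>+\<tau>. m (\<theta>0 + k * \<tau>) \<partial>unit_measure) = ennreal (1 / k) * (\<integral>\<^sup>+\<theta>. m \<theta> * indicator {\<theta>0..\<theta>0 + k} \<theta> \<partial>lborel)"
      by (rule nn_integral_unit_scale[OF mm k(1)])
    also have "(\<integral>\<^sup>+\<theta>. m \<theta> * indicator {\<theta>0..\<theta>0 + k} \<theta> \<partial>lborel) \<le> (\<integral>\<^sup>+\<theta>. m \<theta> * indicator {\<theta>0..\<theta>0 + 1} \<theta> \<partial>lborel)"
      using k by (intro nn_integral_mono) (auto simp: indicator_def)
    also have "(\<integral>\<^sup>+\<theta>. m \<theta> * indicator {\<theta>0..\<theta>0 + 1} \<theta> \<partial>lborel) = (\<integral>\<^sup>+\<tau>. m (\<theta>0 + 1 * \<tau>) \<partial>unit_measure)"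
      using nn_integral_unit_scale[OF mm, of 1 \<theta>0] by simp
    also have "\<dots> = mean_power F t l"
      using nn_integral_unit_shift[OF mm per, of \<theta>0] im by (simp add: add.commute)
    also have "\<dots> \<le> ennreal B" by (rule hardy_boundedD[OF F(2) r])
    finally have "ennreal (cmod (avg (- 4 * pi) (- 2 * pi) k (avg 1 0 h F) z) powr p) \<le> ennreal (1 / h) * (ennreal (1 / k) * ennreal B)"
      by (simp add: mult_left_mono)
    also have "\<dots> = ennreal (B / (h * k))"
      using h k \<open>0 \<le> B\<close> by (simp add: ennreal_mult[symmetric])
    finally show ?thesis using \<open>0 \<le> B\<close> h k by (simp add: ennreal_le_iff)
  qed
  then have "cmod (avg (- 4 * pi) (- 2 * pi) k (avg 1 0 h F) z) \<le> (B / (h * k)) powr (1 / p)" if "z \<in> D' \<beta>" for z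
    using powr_mono2[of "1 / p" "cmod (avg (- 4 * pi) (- 2 * pi) k (avg 1 0 h F) z) powr p"] that p
    by (simp add: powr_powr)
  then show ?thesis by blast
qed

lemma snd_lower_bound:
  assumes "z \<in> D' \<beta>"
  shows "exp (- (\<beta> - pi / 2) / 2) \<le> cmod (snd z)"
proof -
  obtain t l \<omega> where "z = tube_pt t l \<omega>" "(t, l) \<in> rect" using assms by (rule D'_cases)
  then show ?thesis by (auto simp: tube_pt_def norm_mult rect_iff)
qed

text \<open>
  One flow changes only \<open>l\<close> among the coordinates of the rectangle, the other only \<open>t\<close>. Hence nearby
  points \<open>z\<close> and \<open>z'\<close> can be joined inside the domain through the point \<open>z''\<close> that shares \<open>t\<close> with \<open>z\<close> and
  the second coordinate with \<open>z'\<close>. The distance of the second coordinates from \<open>0\<close> is bounded below,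
  so the flow time needed is at most a multiple of the distance.
\<close>

lemma lipschitz_flows_imp_uniformly_continuous:
  assumes L1: "\<And>z \<zeta>. z \<in> D' \<beta> \<Longrightarrow> flow 1 0 \<zeta> z \<in> D' \<beta> \<Longrightarrow> cmod (F (flow 1 0 \<zeta> z) - F z) \<le> L1 * cmod \<zeta>"
    and L2: "\<And>z \<zeta>. z \<in> D' \<beta> \<Longrightarrow> flow (- 4 * pi) (- 2 * pi) \<zeta> z \<in> D' \<beta> \<Longrightarrow>
      cmod (F (flow (- 4 * pi) (- 2 * pi) \<zeta> z) - F z) \<le> L2 * cmod \<zeta>"
    and nonneg: "0 \<le> L1" "0 \<le> L2"
  shows "uniformly_continuous_on (D' \<beta>) F"
proof -
  define q where "q = exp (- (\<beta> - pi / 2) / 2)"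
  define K where "K = L1 + (4 * pi * L1 + L2) * (2 / q)"
  have q: "0 < q" by (simp add: q_def)
  have K: "0 \<le> K" using nonneg q by (simp add: K_def)
  have main: "cmod (F z' - F z) \<le> K * dist z' z" if zD: "z \<in> D' \<beta>" "z' \<in> D' \<beta>" and near: "dist z' z < q / 2" for z z'
  proof -
    have sz: "q \<le> cmod (snd z)" unfolding q_def using zD(1) by (rule snd_lower_bound)
    have ds: "cmod (snd z' - snd z) \<le> dist z' z" and df: "cmod (fst z' - fst z) \<le> dist z' z"
      using dist_snd_le[of z' z] dist_fst_le[of z' z] by (simp_all add: dist_norm)
    define w where "w = (snd z' - snd z) / snd z"
    have snz: "snd z \<noteq> 0" "snd z' \<noteq> 0" using sz q zD by (auto simp: D'_def)
    have "cmod w = cmod (snd z' - snd z) / cmod (snd z)" by (simp add: w_def norm_divide)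
    also have "\<dots> \<le> dist z' z / q" using ds sz q by (intro frac_le) auto
    finally have w: "cmod w \<le> dist z' z / q" .
    also have "\<dots> < 1 / 2" using near q by (simp add: field_simps)
    finally have w2: "cmod w < 1 / 2" .
    have w1: "1 + w = snd z' / snd z" using snz by (simp add: w_def field_simps)
    \<comment> \<open>The time after which the flow has multiplied the second coordinate of \<open>z\<close> by \<open>1 + w\<close>.\<close>
    define \<zeta> where "\<zeta> = Ln (1 + w) / (2 * of_real pi * \<i>)"
    have "cmod (Ln (1 + w)) \<le> 2 * cmod w" using w2 by (rule norm_Ln_le)
    also have "\<dots> \<le> 2 / q * dist z' z" using w by simp
    finally have "cmod (Ln (1 + w)) \<le> 2 / q * dist z' z" .
    moreover have "cmod \<zeta> = cmod (Ln (1 + w)) / (2 * pi)"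
      by (simp add: \<zeta>_def norm_divide norm_mult)
    moreover have "cmod (Ln (1 + w)) / (2 * pi) \<le> cmod (Ln (1 + w)) / 1"
      using pi_gt3 by (intro divide_left_mono) auto
    ultimately have \<zeta>: "cmod \<zeta> \<le> 2 / q * dist z' z" by simp
    define z'' where "z'' = flow (- 4 * pi) (- 2 * pi) \<zeta> z"
    have "- \<i> * of_real (- 2 * pi) * \<zeta> = Ln (1 + w)" by (simp add: \<zeta>_def)
    then have "exp (- \<i> * of_real (- 2 * pi) * \<zeta>) = snd z' / snd z"
      using snz by (simp add: w1)
    then have s: "snd z'' = snd z'" using snz by (simp add: z''_def flow_def)
    have z''D: "z'' \<in> D' \<beta>"
    proof -
      obtain t l \<omega> where tl: "z = tube_pt t l \<omega>" "(t, l) \<in> rect" using zD(1) by (rule D'_cases)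
      obtain t' l' \<omega>' where tl': "z' = tube_pt t' l' \<omega>'" "(t', l') \<in> rect" using zD(2) by (rule D'_cases)
      define l'' where "l'' = l + 2 * (- 2 * pi) * Im \<zeta>"
      define \<omega>'' where "\<omega>'' = (fst \<omega> + - 4 * pi * Re \<zeta>, snd \<omega> - - 2 * pi * Re \<zeta> / (2 * pi))"
      have z'': "z'' = tube_pt t l'' \<omega>''"
        unfolding z''_def tl(1) flow_tube_pt l''_def \<omega>''_def by simp
      have "cmod (snd z'') = exp (l'' / 2)" "cmod (snd z') = exp (l' / 2)"
        by (simp_all add: z'' tl' tube_pt_def norm_mult)
      then have "l'' = l'" using s by simp
      then show ?thesis using tl(2) tl'(2) by (simp add: z'' rect_iff)
    qed
    define \<xi> where "\<xi> = fst z' - fst z''"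
    have z': "z' = flow 1 0 \<xi> z''" using s by (simp add: flow_def \<xi>_def prod_eq_iff)
    have "fst z'' = fst z - 4 * of_real pi * \<zeta>" by (simp add: z''_def flow_def)
    then have "\<xi> = (fst z' - fst z) + 4 * of_real pi * \<zeta>" by (simp add: \<xi>_def)
    then have "cmod \<xi> \<le> cmod (fst z' - fst z) + cmod (4 * of_real pi * \<zeta>)"
      by (simp only: norm_triangle_ineq)
    then have \<xi>: "cmod \<xi> \<le> dist z' z + 4 * pi * cmod \<zeta>"
      using df by (simp add: norm_mult)
    have "cmod (F z' - F z) \<le> cmod (F z' - F z'') + cmod (F z'' - F z)"
      using norm_triangle_ineq[of "F z' - F z''" "F z'' - F z"] by simp
    also have "\<dots> \<le> L1 * cmod \<xi> + L2 * cmod \<zeta>"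
      using L1[OF z''D, of \<xi>, folded z', OF zD(2)] L2[OF zD(1), of \<zeta>, folded z''_def, OF z''D]
      by (rule add_mono)
    also have "\<dots> \<le> L1 * (dist z' z + 4 * pi * cmod \<zeta>) + L2 * cmod \<zeta>"
      using \<xi> nonneg by (intro add_mono mult_left_mono) auto
    also have "\<dots> = L1 * dist z' z + (4 * pi * L1 + L2) * cmod \<zeta>"
      by (simp add: algebra_simps)
    also have "\<dots> \<le> L1 * dist z' z + (4 * pi * L1 + L2) * (2 / q * dist z' z)"
      using \<zeta> nonneg by (intro add_mono mult_left_mono) auto
    also have "\<dots> = K * dist z' z" by (simp add: K_def algebra_simps)
    finally show ?thesis .
  qed
  show ?thesis
    unfolding uniformly_continuous_on_def
  proof (intro allI impI)
    fix e :: real assume e: "0 < e"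
    define \<delta> where "\<delta> = min (q / 2) (e / (K + 1))"
    have \<delta>: "0 < \<delta>" using e q K by (simp add: \<delta>_def)
    have "dist (F z') (F z) < e" if "z \<in> D' \<beta>" "z' \<in> D' \<beta>" "dist z' z < \<delta>" for z z'
    proof -
      have "dist (F z') (F z) \<le> K * dist z' z"
        using main that by (simp add: \<delta>_def dist_norm)
      also have "\<dots> \<le> (K + 1) * dist z' z" by (intro mult_right_mono) auto
      also have "\<dots> < (K + 1) * (e / (K + 1))"
        using that K by (intro mult_strict_left_mono) (auto simp: \<delta>_def)
      also have "\<dots> = e" using K by simp
      finally show ?thesis .
    qed
    with \<delta> show "\<exists>d>0. \<forall>x\<in>D' \<beta>. \<forall>x'\<in>D' \<beta>. dist x' x < d \<longrightarrow> dist (F x') (F x) < e" by blast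
  qed
qed

text \<open>
  The two inner averages make the function bounded, and each of the two outer ones adds a Lipschitz bound
  along its own flow.
\<close>

lemma quadruple_avg_extends:
  assumes F: "F holomorphic2_on D' \<beta>" "hardy_bounded F B" and "0 \<le> B"
    and h: "0 < h1" "0 < h2" "h2 \<le> 1" "0 < h3" "0 < h4"
  shows "extends_continuously_to_closure
    (avg (- 4 * pi) (- 2 * pi) h4 (avg 1 0 h3 (avg (- 4 * pi) (- 2 * pi) h2 (avg 1 0 h1 F)))) (D' \<beta>)"
proof -
  have hol: "avg c d h G holomorphic2_on D' \<beta>" if "G holomorphic2_on D' \<beta>" for c d h G
    using that open_D' by (rule holomorphic2_on_avg) simp
  note cont = holomorphic2_on_imp_continuous_on
  define F2 where "F2 = avg (- 4 * pi) (- 2 * pi) h2 (avg 1 0 h1 F)"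
  define F3 where "F3 = avg 1 0 h3 F2"
  define F4 where "F4 = avg (- 4 * pi) (- 2 * pi) h4 F3"
  have hF2: "F2 holomorphic2_on D' \<beta>" and hF3: "F3 holomorphic2_on D' \<beta>"
    unfolding F3_def F2_def by (intro hol F(1))+
  obtain M0 where M0: "\<And>z. z \<in> D' \<beta> \<Longrightarrow> cmod (F2 z) \<le> M0"
    using double_avg_bounded[OF cont[OF F(1)] F(2) \<open>0 \<le> B\<close> h(1-3) cont[OF hol[OF F(1)]]] by (auto simp: F2_def)
  define M where "M = max M0 0"
  have M: "\<And>z. z \<in> D' \<beta> \<Longrightarrow> cmod (F2 z) \<le> M" "0 \<le> M" using M0 by (auto simp: M_def intro: max.coboundedI1)
  have M3: "cmod (F3 z) \<le> M" if "z \<in> D' \<beta>" for z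
    unfolding F3_def using cont[OF hF2] M(1) that by (rule avg_bounded)
  have "uniformly_continuous_on (D' \<beta>) F4"
  proof (rule lipschitz_flows_imp_uniformly_continuous[where ?L1.0 = "2 * M / h3" and ?L2.0 = "2 * M / h4"])
    fix z \<zeta> assume z: "z \<in> D' \<beta>" "flow 1 0 \<zeta> z \<in> D' \<beta>"
    show "cmod (F4 (flow 1 0 \<zeta> z) - F4 z) \<le> 2 * M / h3 * cmod \<zeta>"
      unfolding F4_def
    proof (rule avg_lipschitz_other_flow[OF cont[OF hF3] _ z])
      show "cmod (F3 (flow 1 0 \<zeta> z) - F3 z) \<le> 2 * M / h3 * cmod \<zeta>" if "z \<in> D' \<beta>" "flow 1 0 \<zeta> z \<in> D' \<beta>" for z
        unfolding F3_def using hF2 M(1) h(4) that by (rule avg_lipschitz_own_flow)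
    qed
  next
    fix z \<zeta> assume z: "z \<in> D' \<beta>" "flow (- 4 * pi) (- 2 * pi) \<zeta> z \<in> D' \<beta>"
    show "cmod (F4 (flow (- 4 * pi) (- 2 * pi) \<zeta> z) - F4 z) \<le> 2 * M / h4 * cmod \<zeta>"
      unfolding F4_def using hF3 M3 h(5) z by (rule avg_lipschitz_own_flow)
  qed (use M(2) h in auto)
  then obtain g where "uniformly_continuous_on (closure (D' \<beta>)) g" "\<And>x. x \<in> D' \<beta> \<Longrightarrow> F4 x = g x"
    by (rule uniformly_continuous_on_extension_on_closure) blast
  then have "extends_continuously_to_closure F4 (D' \<beta>)"
    unfolding extends_continuously_to_closure_def
    by (intro exI[of _ g]) (auto intro: uniformly_continuous_imp_continuous)
  then show ?thesis by (simp only: F4_def F3_def F2_def)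
qed

section \<open>Hardy norm and density\<close>

lemma Lp_op_eq:
  assumes F: "continuous_on (D' \<beta>) F" and r: "(t, l) \<in> rect"
  shows "Lp_op p F t l = mean_power F t l + mean_power F (- t) (- l) + mean_power F (- t) l + mean_power F t (- l)"
proof -
  have r': "(- t, - l) \<in> rect" "(- t, l) \<in> rect" "(t, - l) \<in> rect" using r by (auto simp: rect_iff)
  show ?thesis
    using slice_integral_eq_mean_power[OF F r] slice_integral_eq_mean_power[OF F r'(1)]
      slice_integral_eq_mean_power[OF F r'(2)] slice_integral_eq_mean_power[OF F r'(3)]
    by (simp add: Lp_op_def add.commute)
qed

lemma hardy_sup_le:
  assumes F: "continuous_on (D' \<beta>) F" "hardy_bounded F B" and "0 \<le> B"
  shows "hardy_sup \<beta> p F \<le> ennreal (4 * B)"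
  unfolding hardy_sup_def
proof (rule SUP_least, clarify)
  fix t l :: real assume "t \<in> {0..<pi / 2}" "l \<in> {0..<\<beta> - pi / 2}"
  then have r: "(t, l) \<in> rect" by (simp add: rect_iff)
  then have r': "(- t, - l) \<in> rect" "(- t, l) \<in> rect" "(t, - l) \<in> rect" by (auto simp: rect_iff)
  have "Lp_op p F t l \<le> ennreal B + ennreal B + ennreal B + ennreal B"
    unfolding Lp_op_eq[OF F(1) r] by (intro add_mono hardy_boundedD[OF F(2)] r r')
  also have "\<dots> = ennreal (4 * B)"
    using \<open>0 \<le> B\<close> by (simp add: ennreal_plus[symmetric] del: ennreal_plus)
  finally show "Lp_op p F t l \<le> ennreal (4 * B)" .
qed

lemma mean_power_le_hardy_sup:
  assumes F: "continuous_on (D' \<beta>) F" and r: "(t, l) \<in> rect"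
  shows "mean_power F t l \<le> hardy_sup \<beta> p F"
proof -
  have r': "(\<bar>t\<bar>, \<bar>l\<bar>) \<in> rect" and I: "\<bar>t\<bar> \<in> {0..<pi / 2}" "\<bar>l\<bar> \<in> {0..<\<beta> - pi / 2}"
    using r by (auto simp: rect_iff)
  have "mean_power F t l \<le> Lp_op p F \<bar>t\<bar> \<bar>l\<bar>"
    unfolding Lp_op_eq[OF F r']
    by (cases "0 \<le> t"; cases "0 \<le> l") (auto intro!: add_increasing add_increasing2)
  also have "\<dots> \<le> hardy_sup \<beta> p F"
    unfolding hardy_sup_def using I by (intro SUP_upper2[of "(\<bar>t\<bar>, \<bar>l\<bar>)"]) auto
  finally show ?thesis .
qed

lemma hardy_space_iff:
  "F \<in> hardy_space \<beta> p \<longleftrightarrow> F holomorphic2_on D' \<beta> \<and> (\<exists>B\<ge>0. hardy_bounded F B)"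
proof (intro iffI conjI; (elim conjE exE)?)
  assume F: "F \<in> hardy_space \<beta> p"
  then show hol: "F holomorphic2_on D' \<beta>" by (simp add: hardy_space_def)
  have "hardy_sup \<beta> p F < top" using F by (simp add: hardy_space_def)
  then have "hardy_bounded F (enn2real (hardy_sup \<beta> p F))"
    unfolding hardy_bounded_def using mean_power_le_hardy_sup[OF holomorphic2_on_imp_continuous_on[OF hol]] by auto
  then show "\<exists>B\<ge>0. hardy_bounded F B" by (intro exI[of _ "enn2real (hardy_sup \<beta> p F)"]) simp
next
  fix B assume F: "F holomorphic2_on D' \<beta>" "0 \<le> B" "hardy_bounded F B"
  have "hardy_sup \<beta> p F \<le> ennreal (4 * B)"
    using hardy_sup_le[OF holomorphic2_on_imp_continuous_on[OF F(1)] F(3,2)] .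
  then show "F \<in> hardy_space \<beta> p"
    using F(1) by (auto simp: hardy_space_def intro: le_less_trans)
qed

lemma hardy_bounded_diff_trans:
  assumes F: "continuous_on (D' \<beta>) F" "continuous_on (D' \<beta>) G" "continuous_on (D' \<beta>) H"
    and b: "hardy_bounded (\<lambda>z. F z - G z) a" "hardy_bounded (\<lambda>z. G z - H z) b" and "0 \<le> a" "0 \<le> b"
  shows "hardy_bounded (\<lambda>z. F z - H z) (2 powr p * (a + b))"
  unfolding hardy_bounded_def
proof clarify
  fix t l assume r: "(t, l) \<in> rect"
  have "mean_power (\<lambda>z. F z - H z) t l \<le>
      ennreal (2 powr p) * mean_power (\<lambda>z. F z - G z) t l + ennreal (2 powr p) * mean_power (\<lambda>z. G z - H z) t l"
  proof (rule mean_power_add_le[OF _ _ r])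
    show "cmod (F z - H z) powr p \<le> 2 powr p * cmod (F z - G z) powr p + 2 powr p * cmod (G z - H z) powr p" for z
      using cmod_diff_powr_le[OF p, of "F z - G z" "H z - G z"] by (simp add: distrib_left norm_minus_commute)
  qed (intro continuous_intros F | simp)+
  also have "\<dots> \<le> ennreal (2 powr p) * ennreal a + ennreal (2 powr p) * ennreal b"
    by (intro add_mono mult_left_mono hardy_boundedD[OF b(1) r] hardy_boundedD[OF b(2) r]) auto
  also have "\<dots> = ennreal (2 powr p * (a + b))"
    using \<open>0 \<le> a\<close> \<open>0 \<le> b\<close> by (simp add: ennreal_mult[symmetric] ennreal_plus[symmetric] distrib_left del: ennreal_plus)
  finally show "mean_power (\<lambda>z. F z - H z) t l \<le> ennreal (2 powr p * (a + b))" .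
qed

lemma hardy_space_avg:
  assumes "F \<in> hardy_space \<beta> p"
  shows "avg c d h F \<in> hardy_space \<beta> p"
proof -
  have F: "F holomorphic2_on D' \<beta>" and "\<exists>B\<ge>0. hardy_bounded F B"
    using assms by (auto simp: hardy_space_iff)
  moreover have "avg c d h F holomorphic2_on D' \<beta>"
    using F open_D' by (rule holomorphic2_on_avg) simp
  ultimately show ?thesis
    using hardy_bounded_avg[OF holomorphic2_on_imp_continuous_on[OF F]] by (auto simp: hardy_space_iff)
qed

lemma hardy_space_avg_approximates:
  assumes "F \<in> hardy_space \<beta> p" "0 < \<epsilon>"
  shows "\<exists>h>0. h \<le> 1 \<and> hardy_bounded (\<lambda>z. F z - avg c d h F z) \<epsilon>"
  using assms avg_approximates by (auto simp: hardy_space_iff)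

text \<open>
  Four successive averages, each close to the one before. The quasi-triangle inequality
  \<open>hardy_bounded_diff_trans\<close> costs a factor \<open>c = 2 powr p\<close> at each step, whence the
  precision \<open>\<epsilon> / (4 * c ^ 3)\<close> of the single steps.
\<close>

lemma hardy_approximation:
  assumes F: "F \<in> hardy_space \<beta> p" and \<epsilon>: "0 < \<epsilon>"
  shows "\<exists>G\<in>hardy_space \<beta> p. extends_continuously_to_closure G (D' \<beta>) \<and> hardy_bounded (\<lambda>z. F z - G z) \<epsilon>"
proof -
  define c :: real where "c = 2 powr p"
  have c: "1 \<le> c" unfolding c_def using p by (intro ge_one_powr_ge_zero) auto
  define e where "e = \<epsilon> / (4 * c ^ 3)"
  have e: "0 < e" using \<epsilon> c by (simp add: e_def)
  obtain h1 where h1: "0 < h1" "hardy_bounded (\<lambda>z. F z - avg 1 0 h1 F z) e"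
    using hardy_space_avg_approximates[OF F e] by blast
  define F1 where "F1 = avg 1 0 h1 F"
  have F1: "F1 \<in> hardy_space \<beta> p" unfolding F1_def by (rule hardy_space_avg[OF F])
  obtain h2 where h2: "0 < h2" "h2 \<le> 1" "hardy_bounded (\<lambda>z. F1 z - avg (- 4 * pi) (- 2 * pi) h2 F1 z) e"
    using hardy_space_avg_approximates[OF F1 e] by blast
  define F2 where "F2 = avg (- 4 * pi) (- 2 * pi) h2 F1"
  have F2: "F2 \<in> hardy_space \<beta> p" unfolding F2_def by (rule hardy_space_avg[OF F1])
  obtain h3 where h3: "0 < h3" "hardy_bounded (\<lambda>z. F2 z - avg 1 0 h3 F2 z) e"
    using hardy_space_avg_approximates[OF F2 e] by blast
  define F3 where "F3 = avg 1 0 h3 F2"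
  have F3: "F3 \<in> hardy_space \<beta> p" unfolding F3_def by (rule hardy_space_avg[OF F2])
  obtain h4 where h4: "0 < h4" "hardy_bounded (\<lambda>z. F3 z - avg (- 4 * pi) (- 2 * pi) h4 F3 z) e"
    using hardy_space_avg_approximates[OF F3 e] by blast
  define F4 where "F4 = avg (- 4 * pi) (- 2 * pi) h4 F3"
  have F4: "F4 \<in> hardy_space \<beta> p" unfolding F4_def by (rule hardy_space_avg[OF F3])
  have cont: "continuous_on (D' \<beta>) G" if "G \<in> hardy_space \<beta> p" for G
    using that by (auto simp: hardy_space_iff intro: holomorphic2_on_imp_continuous_on)
  note trans = hardy_bounded_diff_trans[folded c_def]
  have "hardy_bounded (\<lambda>z. F z - F2 z) (c * (e + e))"
    using h1 h2 e by (intro trans[of F F1 F2] cont F F1 F2) (auto simp: F1_def F2_def)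
  then have "hardy_bounded (\<lambda>z. F z - F3 z) (c * (c * (e + e) + e))"
    using h3 e c by (intro trans[of F F2 F3] cont F F3 F2) (auto simp: F3_def)
  then have b: "hardy_bounded (\<lambda>z. F z - F4 z) (c * (c * (c * (e + e) + e) + e))"
    using h4 e c by (intro trans[of F F3 F4] cont F F3 F4) (auto simp: F4_def)
  have "c * (c * (c * (e + e) + e) + e) = (2 * c ^ 3 + c ^ 2 + c) * e"
    by (simp add: power2_eq_square power3_eq_cube algebra_simps)
  also have "\<dots> \<le> (4 * c ^ 3) * e"
  proof (rule mult_right_mono)
    have "c ^ 2 \<le> c ^ 3" "c ^ 1 \<le> c ^ 3" using c by (intro power_increasing; simp)+
    then show "2 * c ^ 3 + c ^ 2 + c \<le> 4 * c ^ 3" by simp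
  qed (use e in simp)
  also have "\<dots> = \<epsilon>" using c by (simp add: e_def)
  finally have "hardy_bounded (\<lambda>z. F z - F4 z) \<epsilon>" by (rule hardy_bounded_mono[OF b])
  moreover have "extends_continuously_to_closure F4 (D' \<beta>)"
  proof -
    obtain B where "F holomorphic2_on D' \<beta>" "hardy_bounded F B" "0 \<le> B"
      using F by (auto simp: hardy_space_iff)
    from quadruple_avg_extends[OF this h1(1) h2(1,2) h3(1) h4(1)]
    show ?thesis unfolding F4_def F3_def F2_def F1_def .
  qed
  ultimately show ?thesis using F4 by blast
qed

lemma hardy_norm_less:
  assumes G: "continuous_on (D' \<beta>) G" "hardy_bounded G (\<epsilon> powr p / 8)" and \<epsilon>: "0 < \<epsilon>"
  shows "hardy_norm \<beta> p G < \<epsilon>"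
proof -
  have "hardy_sup \<beta> p G \<le> ennreal (4 * (\<epsilon> powr p / 8))"
    using G by (intro hardy_sup_le) auto
  from enn2real_mono[OF this] have "enn2real (hardy_sup \<beta> p G) \<le> \<epsilon> powr p / 2" by simp
  also have "\<dots> < \<epsilon> powr p" using \<epsilon> by simp
  finally have "enn2real (hardy_sup \<beta> p G) powr (1 / p) < (\<epsilon> powr p) powr (1 / p)"
    using p by (intro powr_less_mono2) auto
  then show ?thesis using p \<epsilon> by (simp add: hardy_norm_def powr_powr)
qed

lemma hardy_closure_continuous:
  "hardy_closure \<beta> p (hardy_space \<beta> p \<inter> {F. extends_continuously_to_closure F (D' \<beta>)}) = hardy_space \<beta> p"
proof -
  have "\<exists>G\<in>hardy_space \<beta> p \<inter> {F. extends_continuously_to_closure F (D' \<beta>)}. hardy_norm \<beta> p (\<lambda>z. F z - G z) < \<epsilon>"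
    if F: "F \<in> hardy_space \<beta> p" and \<epsilon>: "0 < \<epsilon>" for F \<epsilon>
  proof -
    \<comment> \<open>A factor 4 for the four slices in \<open>Lp_op\<close>, and a factor 2 for the strict inequality.\<close>
    have "0 < \<epsilon> powr p / 8" using \<epsilon> by simp
    from hardy_approximation[OF F this] obtain G where G: "G \<in> hardy_space \<beta> p"
      "extends_continuously_to_closure G (D' \<beta>)" "hardy_bounded (\<lambda>z. F z - G z) (\<epsilon> powr p / 8)" by blast
    have "continuous_on (D' \<beta>) (\<lambda>z. F z - G z)"
      using F G(1) by (auto simp: hardy_space_iff intro!: holomorphic2_on_imp_continuous_on holomorphic2_on_diff)
    then have "hardy_norm \<beta> p (\<lambda>z. F z - G z) < \<epsilon>" using G(3) \<epsilon> by (rule hardy_norm_less)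
    with G show ?thesis by blast
  qed
  then show ?thesis unfolding hardy_closure_def by blast
qed

end

theorem theorem4p15:
  fixes \<beta> p :: real
  assumes "\<beta> > pi / 2" and "1 < p"
  shows "hardy_closure \<beta> p
      (hardy_space \<beta> p \<inter> {F. extends_continuously_to_closure F (D' \<beta>)}) = hardy_space \<beta> p"
proof -
  interpret hardy_domain \<beta> p using assms by unfold_locales
  show ?thesis by (rule hardy_closure_continuous)
qed

end
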